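(* Let $k,l$ denote integers with $k,l\ge 2$. The following statements hold. I. There exists no $1$-uniform graph of any type $(k,l)$. II. If $G$ is a $2$-uniform graph of type $(k,l)$ with $n$ edges and with two exceptional faces of degrees $u$ and $v$, then: 1) The equality $\gcd(u,l)=\gcd(v,l)$ holds. 2) If $t$ is the number defined by $t=\gcd(u,l)=\gcd(v,l)$, then the number $s=\dfrac{n}{n(k,l)}\cdot\dfrac{l}{t}$ is an integer. 3) The exceptional faces are not adjacent unless $k=2$. III. If $G$ is a $2$-uniform graph of type $(k,l)$ with $n$ edges having one exceptional vertex of degree $u$ and one exceptional face of degree $v$, then: 1) The equality $k=l=3$ holds. 2) The number $n$ is even. 3) The exceptional vertex is not incident to the exceptional face.
   Context: "Graph" means a finite connected plane graph (embedded in the sphere) with at least one edge, possibly with multiple edges and loops. The degree of a vertex counts each loop twice; the degree of a face is the length of its boundary walk (an edge having the same face on both sides is counted twice). For integers $k,l\ge2$, call a vertex exceptional if its degree is not divisible by $k$, and a face exceptional if its degree is not divisible by $l$. A graph is $1$-uniform (respectively $2$-uniform) of type $(k,l)$ if the total number of exceptional vertices and exceptional faces is exactly one (respectively exactly two; the two exceptions may be two faces, two vertices, or one vertex and one face). A $2$-uniform graph of type $(k,l)$ can exist only if, up to interchanging $k$ and $l$, $(k,l)$ is one of $(2,r)$ with $r\ge 2$, $(3,3)$, $(3,4)$, $(3,5)$; for these pairs $n(k,l)=\frac{2kl}{2k+2l-kl}$ denotes the number of edges of the unique (Platonic) graph all of whose vertices have degree $k$ and all of whose faces have degree $l$. Two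 faces are adjacent if they share an edge. *)

theory Defs
  imports
    "HOL.Rat"
    "HOL-Combinatorics.Orbits"
    "Graph_Theory.Digraph_Component"
    "Graph_Theory.Bidirected_Digraph"
begin

text \<open>
  A plane graph is given as a rotation system of genus 0 (a combinatorial map on the sphere).
  The underlying multigraph is a bidirected digraph: an edge is a pair of mutually reverse arcs
  \<open>{a, arev a}\<close>, with \<open>arev a \<noteq> a\<close> also when the edge is a loop. The permutation
  \<open>rot\<close> sends an arc to the next arc, in the cyclic order given by the orientation of the
  sphere, among the arcs leaving the same vertex.
\<close>

definition map_edges :: "('v, 'd) pre_digraph \<Rightarrow> ('d \<Rightarrow> 'd) \<Rightarrow> 'd set set" where
  "map_edges G arev = {{a, arev a} | a. a \<in> arcs G}"

text \<open>
  A face is identified with the set of arcs of its boundary walk: having traversed \<open>a\<close>,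
  the walk continues with the arc following \<open>arev a\<close> around the head of \<open>a\<close>.
\<close>

definition map_faces ::
    "('v, 'd) pre_digraph \<Rightarrow> ('d \<Rightarrow> 'd) \<Rightarrow> ('d \<Rightarrow> 'd) \<Rightarrow> 'd set set" where
  "map_faces G arev rot = orbit (rot \<circ> arev) ` arcs G"

locale plane_graph = fin_digraph G + bidirected_digraph G arev
  for G :: "('v, 'd) pre_digraph" and arev :: "'d \<Rightarrow> 'd" +
  fixes rot :: "'d \<Rightarrow> 'd"
  assumes rot_permutes: "rot permutes arcs G"
    and rot_cyclic:
      "\<And>x. \<lbrakk>x \<in> verts G; out_arcs G x \<noteq> {}\<rbrakk> \<Longrightarrow> cyclic_on rot (out_arcs G x)"
    and connected: "Digraph_Component.connected G"
    and has_edge: "map_edges G arev \<noteq> {}"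
    and sphere: "int (card (verts G)) - int (card (map_edges G arev))
                   + int (card (map_faces G arev rot)) = 2"
      \<comment> \<open>The surface obtained by gluing a disc along every boundary walk is the sphere.\<close>

text \<open>
  A loop contributes two of the arcs leaving its vertex, and an edge with the same face on both
  sides contributes both of its arcs to that face.
\<close>

definition vertex_degree :: "('v, 'd) pre_digraph \<Rightarrow> 'v \<Rightarrow> nat" where
  "vertex_degree G x = out_degree G x"

definition face_degree :: "'d set \<Rightarrow> nat" where
  "face_degree f = card f"

definition exceptional_vertices :: "nat \<Rightarrow> ('v, 'd) pre_digraph \<Rightarrow> 'v set" where
  "exceptional_vertices k G = {x \<in> verts G. \<not> k dvd vertex_degree G x}"

definition exceptional_faces ::
    "nat \<Rightarrow> ('v, 'd) pre_digraph \<Rightarrow> ('d \<Rightarrow> 'd) \<Rightarrow> ('d \<Rightarrow> 'd) \<Rightarrow> 'd set set" where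
  "exceptional_faces l G arev rot = {f \<in> map_faces G arev rot. \<not> l dvd face_degree f}"

definition uniform_of_type ::
    "nat \<Rightarrow> nat \<Rightarrow> nat \<Rightarrow> ('v, 'd) pre_digraph \<Rightarrow> ('d \<Rightarrow> 'd) \<Rightarrow> ('d \<Rightarrow> 'd) \<Rightarrow> bool" where
  "uniform_of_type m k l G arev rot \<longleftrightarrow>
     card (exceptional_vertices k G) + card (exceptional_faces l G arev rot) = m"

definition faces_adjacent ::
    "('v, 'd) pre_digraph \<Rightarrow> ('d \<Rightarrow> 'd) \<Rightarrow> 'd set \<Rightarrow> 'd set \<Rightarrow> bool" where
  "faces_adjacent G arev f g \<longleftrightarrow>
     (\<exists>e \<in> map_edges G arev. e \<inter> f \<noteq> {} \<and> e \<inter> g \<noteq> {})"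

definition incident :: "('v, 'd) pre_digraph \<Rightarrow> 'v \<Rightarrow> 'd set \<Rightarrow> bool" where
  "incident G x f \<longleftrightarrow> (\<exists>a \<in> f. tail G a = x)"

text \<open>
  The number of edges of the Platonic graph of type \<open>(k, l)\<close>. It has this meaning only for
  \<open>2 * k + 2 * l > k * l\<close>, which holds whenever a 2-uniform graph of that type exists.
\<close>

definition platonic_edges :: "nat \<Rightarrow> nat \<Rightarrow> rat" where
  "platonic_edges k l =
     2 * of_nat k * of_nat l / (2 * of_nat k + 2 * of_nat l - of_nat k * of_nat l)"

end

theory Submission
  imports Defs
begin

text \<open>
  Let \<open>x\<close> and \<open>z\<close> be the vertex rotation and the reversal of darts of the Platonic map of type
  \<open>(k, l)\<close>, acting on its set \<open>T\<close> of darts. Let \<open>D\<close> be the set of darts of the given graph, and let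
  the rotation and the reversal act on \<open>D \<times> T\<close> by acting on both coordinates. Every orbit of this
  action is a connected map \<open>K\<close> that covers the graph with some number \<open>N\<close> of sheets and also
  projects to the Platonic map. A vertex of degree \<open>u\<close> acts on the fibre by the power \<open>x ^ u\<close>, which
  has order \<open>m = k div gcd u k\<close> and permutes the darts in cycles of the same length \<open>m\<close>; likewise for
  faces. So the covering is branched exactly over the exceptional vertices and faces, with
  branching order \<open>m \<ge> 2\<close>, and every such \<open>m\<close> is at most \<open>N\<close>.

  The numerical statements come from the inequality \<open>V - E + F \<le> 2\<close> for \<open>K\<close>
  (\<open>connected_map.euler_inequality\<close>, valid for connected maps on any surface). As the graph has Euler
  characteristic exactly 2, it reads \<open>N (2 - \<Sum> (1 - 1 / m)) \<le> 2\<close>, summed over the exceptions.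
  With one exception it gives \<open>N (1 + 1 / m) \<le> 2\<close>, which contradicts \<open>N \<ge> m \<ge> 2\<close>. With two exceptions
  it gives \<open>N / m + N / m' \<le> 2\<close> and therefore \<open>m = m' = N\<close>. This is the equality of the greatest
  common divisors. The fibres of the projection to the Platonic map have equal size, so that
  \<open>card T\<close> divides \<open>N * card D\<close>, which is the integrality statement; for \<open>k = l = 3\<close> it says that the
  number of edges is even. When an exceptional vertex and an exceptional face occur together,
  \<open>m\<close> divides both \<open>k\<close> and \<open>l\<close>, and the handshake lemma excludes that one of them is 2; only
  \<open>k = l = 3\<close> remains.

  Finally, \<open>N = m\<close> means that over a dart of an exceptional face the darts of \<open>K\<close> are obtained
  from each other by turning around a single face of the Platonic map. If two exceptional faces had a common
  edge, then the holonomy of the second, carried across the edge, would do so too, and two adjacent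
  Platonic faces would have two common edges. An exceptional vertex at a corner of an exceptional
  face would in the same way force a vertex and a face of the tetrahedron to share two darts.

  Only the finite triangle groups are needed: counting vertices and faces by their degrees shows
  that at most two exceptions are possible only if \<open>k l < 2 (k + l)\<close> (\<open>spherical_map.spherical_type\<close>). The
  Platonic maps are given explicitly, by a formula for dihedra and by tables for the tetrahedron,
  the cube and the dodecahedron, and by duality for the rest.
\<close>

section \<open>Orbits of a permutation of a finite set\<close>

lemma self_in_orbit:
  assumes "finite S" and "bij_betw f S S" and "s \<in> S"
  shows "s \<in> orbit f s"
proof -
  let ?g = "perm_restrict f S"
  have "bij_betw ?g S S"
    using assms(2) by (rule bij_betw_cong[THEN iffD1, rotated]) (simp add: perm_restrict_def)
  then have "?g permutes S"
    by (rule bij_imp_permutes) (simp add: perm_restrict_def)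
  then have "s \<in> orbit ?g s"
    using assms(1) by (intro permutation_self_in_orbit) (auto simp: permutation_permutes)
  moreover have "orbit f s = orbit ?g s"
    using assms by (intro orbit_cong0[of s S]) (auto simp: perm_restrict_def bij_betw_def)
  ultimately show ?thesis by simp
qed

lemma self_in_orbitI:
  assumes "(f ^^ n) s = s" and "0 < n"
  shows "s \<in> orbit f s"
  unfolding orbit_altdef using assms by (intro CollectI exI[of _ n]) simp

lemma orbit_subset_of_closed:
  assumes "s \<in> S" and "f ` S \<subseteq> S"
  shows "orbit f s \<subseteq> S"
proof
  fix t assume "t \<in> orbit f s"
  then show "t \<in> S" using assms by induction auto
qed

lemma orbit_eq_of_mem:
  assumes "s \<in> orbit f s" and "t \<in> orbit f s"
  shows "orbit f t = orbit f s"
  using assms by (auto intro: orbit_swap orbit_trans)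

lemma orbit_eq_iff_mem:
  assumes "finite S" and "bij_betw f S S" and "s \<in> S" and "t \<in> S"
  shows "orbit f t = orbit f s \<longleftrightarrow> t \<in> orbit f s"
  using assms by (metis orbit_eq_of_mem self_in_orbit)

lemma card_orbit_pos:
  assumes "s \<in> orbit f s"
  shows "0 < card (orbit f s)"
  using assms by (auto simp: card_gt_0_iff intro: finite_orbit)

lemma funpow_card_orbit:
  assumes "s \<in> orbit f s"
  shows "(f ^^ card (orbit f s)) s = s"
proof -
  have "card (orbit f s) = funpow_dist1 f s s"
    by (subst orbit_conv_funpow_dist1[OF assms])
      (simp add: card_image inj_on_funpow_dist1[OF assms])
  then show ?thesis using funpow_dist1_prop[OF assms] by simp
qed

lemma funpow_fixes_iff:
  assumes "s \<in> orbit f s"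
  shows "(f ^^ n) s = s \<longleftrightarrow> card (orbit f s) dvd n"
proof -
  let ?c = "card (orbit f s)"
  have mod: "(f ^^ (n mod ?c)) s = (f ^^ n) s"
    by (rule funpow_mod_eq[OF funpow_card_orbit[OF assms]])
  show ?thesis
  proof
    assume "(f ^^ n) s = s"
    show "?c dvd n"
    proof (rule ccontr)
      assume "\<not> ?c dvd n"
      then have r: "0 < n mod ?c" by (simp add: mod_greater_zero_iff_not_dvd)
      have "orbit f s = {(f ^^ m) s |m. m < n mod ?c}"
        using \<open>(f ^^ n) s = s\<close> mod r by (intro orbit_altdef_bounded) simp_all
      also have "\<dots> = (\<lambda>m. (f ^^ m) s) ` {..<n mod ?c}" by auto
      finally have "?c \<le> n mod ?c"
        by (metis card_image_le card_lessThan finite_lessThan)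
      moreover have "n mod ?c < ?c" using card_orbit_pos[OF assms] by simp
      ultimately show False by simp
    qed
  next
    assume "?c dvd n"
    then show "(f ^^ n) s = s" using mod by (simp add: mod_eq_0_iff_dvd)
  qed
qed

lemma self_in_orbit_funpow:
  assumes "s \<in> orbit f s"
  shows "s \<in> orbit (f ^^ n) s"
proof -
  have "((f ^^ n) ^^ card (orbit f s)) s = s"
    using funpow_fixes_iff[OF assms, of "n * card (orbit f s)"] by (simp add: funpow_mult)
  then show ?thesis
    using card_orbit_pos[OF assms] by (rule self_in_orbitI)
qed

lemma orbit_funpow_subset:
  assumes "s \<in> orbit f s"
  shows "orbit (f ^^ n) s \<subseteq> orbit f s"
proof
  fix t assume "t \<in> orbit (f ^^ n) s"
  then obtain m where "t = (f ^^ (n * m)) s"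
    by (auto simp: orbit_altdef funpow_mult)
  then show "t \<in> orbit f s" using funpow_in_orbit[OF assms] by simp
qed

text \<open>
  For a cycle of length \<open>k\<close> the orbits of the \<open>n\<close>-th power have length \<open>k div gcd n k\<close>: this is the
  branching order over a vertex or face of degree \<open>n\<close>.
\<close>

lemma card_orbit_funpow:
  assumes "s \<in> orbit f s"
  shows "card (orbit (f ^^ n) s) * gcd n (card (orbit f s)) = card (orbit f s)"
proof -
  let ?c = "card (orbit f s)"
  have pos: "?c > 0" by (rule card_orbit_pos[OF assms])
  have *: "card (orbit (f ^^ n) s) dvd m \<longleftrightarrow> ?c div gcd n ?c dvd m" for m
  proof -
    have "card (orbit (f ^^ n) s) dvd m \<longleftrightarrow> ((f ^^ n) ^^ m) s = s"
      using funpow_fixes_iff[OF self_in_orbit_funpow[OF assms]] by simp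
    also have "\<dots> \<longleftrightarrow> ?c dvd n * m"
      using funpow_fixes_iff[OF assms] by (simp add: funpow_mult)
    also have "\<dots> \<longleftrightarrow> ?c div gcd n ?c dvd m"
    proof -
      have cop: "coprime (?c div gcd n ?c) (n div gcd n ?c)"
        using pos by (metis coprime_commute div_gcd_coprime not_gr_zero)
      have "?c dvd n * m \<longleftrightarrow>
          gcd n ?c * (?c div gcd n ?c) dvd gcd n ?c * ((n div gcd n ?c) * m)"
        by (simp add: mult.assoc[symmetric])
      also have "\<dots> \<longleftrightarrow> ?c div gcd n ?c dvd (n div gcd n ?c) * m"
        using pos by (intro dvd_times_left_cancel_iff) auto
      also have "\<dots> \<longleftrightarrow> ?c div gcd n ?c dvd m"
        using cop by (simp add: coprime_dvd_mult_right_iff)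
      finally show ?thesis .
    qed
    finally show ?thesis .
  qed
  have "card (orbit (f ^^ n) s) = ?c div gcd n ?c"
    using *[of "card (orbit (f ^^ n) s)"] *[of "?c div gcd n ?c"] by (simp add: dvd_antisym)
  then show ?thesis by simp
qed

lemma map_prod_funpow:
  fixes f :: "'a \<Rightarrow> 'a" and g :: "'b \<Rightarrow> 'b"
  shows "(map_prod f g ^^ n) p = ((f ^^ n) (fst p), (g ^^ n) (snd p))"
  by (induction n) (auto simp: prod_eq_iff)

lemma card_orbit_map_prod:
  assumes "d \<in> orbit f d" and "t \<in> orbit g t"
  shows "card (orbit (map_prod f g) (d, t)) = lcm (card (orbit f d)) (card (orbit g t))"
proof -
  let ?u = "card (orbit f d)" and ?k = "card (orbit g t)"
  have fix_iff: "(map_prod f g ^^ n) (d, t) = (d, t) \<longleftrightarrow> lcm ?u ?k dvd n" for n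
    using assms by (simp add: map_prod_funpow funpow_fixes_iff)
  have "lcm ?u ?k > 0" using assms by (simp add: card_orbit_pos lcm_pos_nat)
  then have self: "(d, t) \<in> orbit (map_prod f g) (d, t)"
    using fix_iff[of "lcm ?u ?k"] by (intro self_in_orbitI) auto
  have *: "card (orbit (map_prod f g) (d, t)) dvd n \<longleftrightarrow> lcm ?u ?k dvd n" for n
    by (rule trans[OF funpow_fixes_iff[OF self, symmetric] fix_iff])
  show ?thesis
    using *[of "lcm ?u ?k"] *[of "card (orbit (map_prod f g) (d, t))"] by (intro dvd_antisym) auto
qed

text \<open>
  Spreading the value at an orbit evenly over its elements turns a sum over orbits into a sum
  over points, which can then be pulled back along a covering. With constant value 1 it counts
  orbits.
\<close>

lemma sum_over_orbits:
  fixes h :: "'a set \<Rightarrow> rat"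
  assumes "finite S" and "bij_betw f S S"
  shows "(\<Sum>s\<in>S. h (orbit f s) / of_nat (card (orbit f s))) = (\<Sum>c\<in>orbit f ` S. h c)"
proof -
  have "(\<Sum>s\<in>S. h (orbit f s) / of_nat (card (orbit f s)))
      = (\<Sum>c\<in>orbit f ` S. \<Sum>s\<in>{s \<in> S. orbit f s = c}. h (orbit f s) / of_nat (card (orbit f s)))"
    using assms(1) by (rule sum.image_gen)
  also have "\<dots> = (\<Sum>c\<in>orbit f ` S. h c)"
  proof (rule sum.cong[OF refl])
    fix c assume "c \<in> orbit f ` S"
    then obtain s where s: "s \<in> S" "c = orbit f s" by auto
    have sub: "orbit f s \<subseteq> S"
      using s assms(2) by (intro orbit_subset_of_closed) (auto simp: bij_betw_def)
    have "{t \<in> S. orbit f t = c} = orbit f s"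
      using sub s orbit_eq_iff_mem[OF assms s(1)] by auto
    moreover have "card (orbit f s) > 0"
      using self_in_orbit[OF assms s(1)] by (rule card_orbit_pos)
    ultimately show "(\<Sum>t\<in>{t \<in> S. orbit f t = c}. h (orbit f t) / of_nat (card (orbit f t))) = h c"
      using s by (simp cong: sum.cong add: orbit_eq_of_mem[OF self_in_orbit[OF assms s(1)]])
  qed
  finally show ?thesis .
qed

section \<open>The Euler inequality for connected maps\<close>

lemma bij_comp_transpose:
  assumes "bij_betw f S S" and "a \<in> S" and "b \<in> S"
  shows "bij_betw (f \<circ> transpose a b) S S"
  using assms by (intro bij_betw_trans[OF _ assms(1)] permutes_imp_bij permutes_swap_id)

lemma orbit_comp_transpose_avoiding:
  assumes "a \<notin> orbit f s" and "b \<notin> orbit f s" and "s \<in> orbit f s"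
  shows "orbit (f \<circ> transpose a b) s = orbit f s"
  using assms(3)
proof (rule orbit_cong)
  fix t assume "t \<in> orbit f s"
  then have "t \<noteq> a" "t \<noteq> b" using assms by auto
  then show "(f \<circ> transpose a b) t = f t" by (simp add: transpose_def)
qed

text \<open>
  If the orbits of \<open>a\<close> and \<open>b\<close> under \<open>f\<close> differ, the new permutation jumps from \<open>a\<close> into the
  orbit of \<open>b\<close> and follows it around, up to \<open>b\<close> itself.
\<close>

lemma transpose_merges_orbits:
  assumes "b \<in> orbit f b" and "a \<notin> orbit f b"
  shows "b \<in> orbit (f \<circ> transpose a b) a"
proof -
  define g where "g = f \<circ> transpose a b"
  have ga: "g a = f b" by (simp add: g_def)
  have g: "g t = f t" if "t \<noteq> a" "t \<noteq> b" for t using that by (simp add: g_def transpose_def)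
  have "(f ^^ n) b \<in> orbit g a \<or> b \<in> orbit g a" if "n > 0" for n
    using that
  proof (induction n)
    case (Suc n)
    show ?case
    proof (cases "n = 0 \<or> b \<in> orbit g a")
      case True
      then show ?thesis using orbit.base[of g a] ga by auto
    next
      case False
      then have "(f ^^ n) b \<in> orbit g a" using Suc by auto
      moreover have "(f ^^ n) b \<noteq> a"
        using assms funpow_in_orbit[OF assms(1), of n] by auto
      moreover have "(f ^^ n) b \<noteq> b" using False calculation by auto
      ultimately have "f ((f ^^ n) b) \<in> orbit g a" using g orbit.step by metis
      then show ?thesis by simp
    qed
  qed simp
  from this[of "card (orbit f b)"] show ?thesis
    using card_orbit_pos[OF assms(1)] funpow_card_orbit[OF assms(1)] by (simp add: g_def)
qed

text \<open>
  Composing with a transposition cuts one orbit in two or joins two orbits: orbits that avoid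
  both points are not affected.
\<close>

lemma card_orbits_comp_transpose:
  assumes "finite S" and "bij_betw f S S" and "a \<in> S" and "b \<in> S"
  shows "card (orbit (f \<circ> transpose a b) ` S) \<le> card (orbit f ` S) + 1"
    and "b \<notin> orbit f a \<Longrightarrow> card (orbit (f \<circ> transpose a b) ` S) + 1 \<le> card (orbit f ` S)"
proof -
  let ?g = "f \<circ> transpose a b"
  let ?R = "orbit f ` S - {orbit f a, orbit f b}"
  have g: "bij_betw ?g S S" using assms by (intro bij_comp_transpose)
  have gg: "?g \<circ> transpose a b = f" by (simp add: comp_assoc)
  have sub: "orbit ?g ` S \<subseteq> ?R \<union> {orbit ?g a, orbit ?g b}"
  proof
    fix c assume "c \<in> orbit ?g ` S"
    then obtain s where s: "s \<in> S" "c = orbit ?g s" by auto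
    note self = self_in_orbit[OF assms(1) g s(1)]
    show "c \<in> ?R \<union> {orbit ?g a, orbit ?g b}"
    proof (cases "a \<in> orbit ?g s \<or> b \<in> orbit ?g s")
      case True
      then show ?thesis using s orbit_eq_of_mem[OF self] by auto
    next
      case False
      then have "orbit (?g \<circ> transpose a b) s = orbit ?g s"
        using self by (intro orbit_comp_transpose_avoiding) auto
      then have c: "c = orbit f s" using gg s by simp
      moreover have "orbit f a \<noteq> c" "orbit f b \<noteq> c"
        using False s c self_in_orbit[OF assms(1,2)] assms(3,4) by auto
      ultimately show ?thesis using s by auto
    qed
  qed
  have fin: "finite (orbit f ` S)" using assms by simp
  have ab: "orbit f a \<in> orbit f ` S" "orbit f b \<in> orbit f ` S" using assms by auto
  have le: "card (orbit ?g ` S) \<le> card ?R + card {orbit ?g a, orbit ?g b}"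
    using sub fin by (meson card_Un_le card_mono finite.emptyI finite.insertI finite_Diff
        finite_UnI order_trans)
  have R: "card ?R = card (orbit f ` S) - card {orbit f a, orbit f b}"
    using ab by (intro card_Diff_subset) auto
  have R_le: "card {orbit f a, orbit f b} \<le> card (orbit f ` S)"
    using ab fin by (intro card_mono) auto
  have "1 \<le> card {orbit f a, orbit f b}" "card {orbit ?g a, orbit ?g b} \<le> 2"
    by (auto simp: card_insert_if)
  then show "card (orbit ?g ` S) \<le> card (orbit f ` S) + 1"
    using le R R_le by linarith
  assume b: "b \<notin> orbit f a"
  then have ne: "orbit f a \<noteq> orbit f b"
    using self_in_orbit[OF assms(1,2,4)] by auto
  then have "card {orbit f a, orbit f b} = 2" by simp
  moreover have "b \<in> orbit ?g a"
  proof (rule transpose_merges_orbits)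
    show "b \<in> orbit f b" by (rule self_in_orbit[OF assms(1,2,4)])
    show "a \<notin> orbit f b"
      using ne orbit_eq_iff_mem[OF assms(1,2,4,3)] by simp
  qed
  then have "orbit ?g b = orbit ?g a"
    using orbit_eq_of_mem self_in_orbit[OF assms(1) g assms(3)] by metis
  then have "card {orbit ?g a, orbit ?g b} = 1" by simp
  ultimately show "card (orbit ?g ` S) + 1 \<le> card (orbit f ` S)"
    using le R R_le by linarith
qed

text \<open>
  The labelling plays the part of the connected components: two points with different labels lie
  in different components, and the bound is \<open>V - E + F \<le> 2 C\<close>. Start from the graph without
  edges, where \<open>V = F = C\<close>, and insert the edges one by one. An edge inside a face adds at most
  one face. An edge between two faces joins them, so that \<open>V - E + F\<close> drops by 2, and forces at
  most two labels to become equal.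
\<close>

lemma euler_inequality_labelling:
  assumes "finite S" and "bij_betw \<sigma> S S"
    and "\<And>s. s \<in> S \<Longrightarrow> \<alpha> s \<in> S" and "\<And>s. s \<in> S \<Longrightarrow> \<alpha> (\<alpha> s) = s"
  shows "\<exists>p :: 'a \<Rightarrow> 'a set. (\<forall>s\<in>S. p (\<sigma> s) = p s \<and> p (\<alpha> s) = p s) \<and>
      2 * (card (orbit \<sigma> ` S) + card (orbit (\<sigma> \<circ> \<alpha>) ` S)) \<le> 4 * card (p ` S) + card {s\<in>S. \<alpha> s \<noteq> s}"
  using assms(3,4)
proof (induction "card {s\<in>S. \<alpha> s \<noteq> s}" arbitrary: \<alpha> rule: less_induct)
  case less
  show ?case
  proof (cases "{s\<in>S. \<alpha> s \<noteq> s} = {}")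
    case True
    have "orbit (\<sigma> \<circ> \<alpha>) s = orbit \<sigma> s" if "s \<in> S" for s
      using that True assms(2)
      by (intro orbit_cong0[symmetric, of s S]) (auto simp: bij_betw_def)
    then have "orbit (\<sigma> \<circ> \<alpha>) ` S = orbit \<sigma> ` S" by simp
    moreover have "orbit \<sigma> (\<sigma> s) = orbit \<sigma> s" if "s \<in> S" for s
      using self_in_orbit[OF assms(1,2) that] by (rule self_in_orbit_step)
    ultimately show ?thesis using True by (intro exI[of _ "orbit \<sigma>"]) auto
  next
    case False
    then obtain a where a: "a \<in> S" "\<alpha> a \<noteq> a" by auto
    define b where "b = \<alpha> a"
    have b: "b \<in> S" "b \<noteq> a" "\<alpha> b = a" "\<alpha> a = b" using a less.prems by (auto simp: b_def)
    define \<beta> where "\<beta> = \<alpha> \<circ> transpose a b"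
    have \<beta>: "\<beta> s = (if s = a \<or> s = b then s else \<alpha> s)" for s
      using b by (auto simp: \<beta>_def transpose_def)
    have moved: "{s\<in>S. \<alpha> s \<noteq> s} = insert a (insert b {s\<in>S. \<beta> s \<noteq> s})"
      using a b by (auto simp: \<beta>)
    have card: "card {s\<in>S. \<alpha> s \<noteq> s} = card {s\<in>S. \<beta> s \<noteq> s} + 2"
      unfolding moved using assms(1) b by (subst card_insert_disjoint | auto simp: \<beta>)+
    have "\<beta> s \<in> S \<and> \<beta> (\<beta> s) = s" if "s \<in> S" for s
      using that less.prems[OF that] b by (auto simp: \<beta>)
    then obtain p :: "'a \<Rightarrow> 'a set"
      where p: "\<forall>s\<in>S. p (\<sigma> s) = p s \<and> p (\<beta> s) = p s"
        and bound: "2 * (card (orbit \<sigma> ` S) + card (orbit (\<sigma> \<circ> \<beta>) ` S))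
          \<le> 4 * card (p ` S) + card {s\<in>S. \<beta> s \<noteq> s}"
      using less.hyps[of \<beta>] card by auto
    then have inv: "\<And>s. s \<in> S \<Longrightarrow> p (\<sigma> s) = p s" "\<And>s. s \<in> S \<Longrightarrow> p (\<beta> s) = p s"
      by auto
    have comp: "\<sigma> \<circ> \<alpha> = (\<sigma> \<circ> \<beta>) \<circ> transpose a b" by (simp add: \<beta>_def comp_assoc)
    have "bij_betw \<alpha> S S"
      using less.prems by (intro bij_betw_byWitness[of _ \<alpha>]) auto
    then have "bij_betw \<beta> S S" unfolding \<beta>_def using a b by (intro bij_comp_transpose)
    then have \<phi>: "bij_betw (\<sigma> \<circ> \<beta>) S S" using assms(2) bij_betw_trans by blast
    have inv_step: "(\<sigma> \<circ> \<beta>) s \<in> S \<and> p ((\<sigma> \<circ> \<beta>) s) = p s" if "s \<in> S" for s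
      using inv that bij_betwE[OF \<phi>] bij_betwE[OF \<open>bij_betw \<beta> S S\<close>] by simp
    have inv_\<phi>: "p t = p s" if "s \<in> S" "t \<in> orbit (\<sigma> \<circ> \<beta>) s" for s t
    proof -
      have "t \<in> S \<and> p t = p s" using that(2)
      proof induction
        case base
        show ?case by (rule inv_step[OF that(1)])
      next
        case (step y)
        show ?case
          using inv_step[OF conjunct1[OF step.IH]] conjunct2[OF step.IH] by metis
      qed
      then show ?thesis by simp
    qed
    have inv_\<alpha>: "q (\<alpha> s) = q s"
      if "q a = q b" and "\<And>s. s \<in> S \<Longrightarrow> q (\<beta> s) = q s" and "s \<in> S" for q :: "'a \<Rightarrow> 'a set" and s
      using that(1) that(2)[OF that(3)] b \<beta>[of s] by metis
    show ?thesis
    proof (cases "b \<in> orbit (\<sigma> \<circ> \<beta>) a")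
      case True
      then have "p a = p b" using inv_\<phi> a by metis
      moreover have "card (orbit (\<sigma> \<circ> \<alpha>) ` S) \<le> card (orbit (\<sigma> \<circ> \<beta>) ` S) + 1"
        unfolding comp by (rule card_orbits_comp_transpose(1)[OF assms(1) \<phi> a(1) b(1)])
      ultimately show ?thesis
        using inv inv_\<alpha>[of p] bound card by (intro exI[of _ p]) auto
    next
      case False
      then have join: "card (orbit (\<sigma> \<circ> \<alpha>) ` S) + 1 \<le> card (orbit (\<sigma> \<circ> \<beta>) ` S)"
        unfolding comp by (rule card_orbits_comp_transpose(2)[OF assms(1) \<phi> a(1) b(1)])
      \<comment> \<open>the label of \<open>b\<close> is identified with the label of \<open>a\<close>\<close>
      define q where "q = (\<lambda>s. if p s = p b then p a else p s)"
      have "p ` S \<subseteq> insert (p b) (q ` S)" by (auto simp: q_def)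
      then have "card (p ` S) \<le> card (insert (p b) (q ` S))"
        using assms(1) by (intro card_mono) auto
      also have "\<dots> \<le> card (q ` S) + 1" by (simp add: card_insert_le_m1 card_insert_if assms(1))
      finally have "card (p ` S) \<le> card (q ` S) + 1" .
      moreover have "q a = q b" "\<And>s. s \<in> S \<Longrightarrow> q (\<beta> s) = q s" "\<And>s. s \<in> S \<Longrightarrow> q (\<sigma> s) = q s"
        using inv by (auto simp: q_def)
      ultimately show ?thesis
        using inv_\<alpha>[of q] bound card join by (intro exI[of _ q]) auto
    qed
  qed
qed

lemma orbit_of_member:
  assumes "finite S" and "bij_betw f S S" and "c \<in> orbit f ` S" and "d \<in> c"
  shows "d \<in> S" and "orbit f d = c"
proof -
  obtain s where s: "s \<in> S" "c = orbit f s" using assms(3) by blast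
  have "orbit f s \<subseteq> S"
    using s(1) assms(2) by (intro orbit_subset_of_closed) (simp_all add: bij_betw_def)
  then show "d \<in> S" using assms(4) s(2) by blast
  show "orbit f d = c"
    using orbit_eq_of_mem[OF self_in_orbit[OF assms(1,2) s(1)]] assms(4) s(2) by simp
qed

section \<open>Connected combinatorial maps and equivariant projections\<close>

text \<open>
  Connected maps on arbitrary orientable surfaces; connectedness is transitivity of the group
  generated by the two permutations. The set \<open>S\<close> consists of the darts, and the permutation
  \<open>\<sigma> \<circ> \<alpha>\<close> has the faces as its orbits.
\<close>

locale connected_map =
  fixes S :: "'a set" and \<sigma> \<alpha> :: "'a \<Rightarrow> 'a"
  assumes finite: "finite S"
    and nonempty: "S \<noteq> {}"
    and bij_\<sigma>: "bij_betw \<sigma> S S"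
    and \<alpha>_in: "s \<in> S \<Longrightarrow> \<alpha> s \<in> S"
    and \<alpha>_\<alpha>: "s \<in> S \<Longrightarrow> \<alpha> (\<alpha> s) = s"
    and \<alpha>_neq: "s \<in> S \<Longrightarrow> \<alpha> s \<noteq> s"
    and transitive: "\<lbrakk>A \<subseteq> S; A \<noteq> {}; \<sigma> ` A \<subseteq> A; \<alpha> ` A \<subseteq> A\<rbrakk> \<Longrightarrow> A = S"
begin

lemma \<sigma>_in: "s \<in> S \<Longrightarrow> \<sigma> s \<in> S"
  using bij_\<sigma> by (auto simp: bij_betw_def)

lemma bij_\<alpha>: "bij_betw \<alpha> S S"
  using \<alpha>_in \<alpha>_\<alpha> by (intro bij_betw_byWitness[of _ \<alpha>]) auto

lemma bij_\<phi>: "bij_betw (\<sigma> \<circ> \<alpha>) S S"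
  using bij_\<alpha> bij_\<sigma> by (rule bij_betw_trans)

lemma invariant_constant:
  assumes "\<And>s. s \<in> S \<Longrightarrow> p (\<sigma> s) = p s" and "\<And>s. s \<in> S \<Longrightarrow> p (\<alpha> s) = p s"
    and "s \<in> S" and "t \<in> S"
  shows "p s = p t"
proof -
  have "{r \<in> S. p r = p t} = S"
  proof (rule transitive)
    show "{r \<in> S. p r = p t} \<noteq> {}" using assms(4) by blast
  qed (use assms \<sigma>_in \<alpha>_in in \<open>simp_all add: image_subset_iff\<close>)
  then show ?thesis using assms(3) by blast
qed

text \<open>
  Invariant labels are constant by transitivity, so there is only one component.
\<close>

lemma euler_inequality:
  "2 * (card (orbit \<sigma> ` S) + card (orbit (\<sigma> \<circ> \<alpha>) ` S)) \<le> card S + 4"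
proof -
  obtain p :: "'a \<Rightarrow> 'a set" where
    inv: "\<forall>s\<in>S. p (\<sigma> s) = p s \<and> p (\<alpha> s) = p s" and
    bound: "2 * (card (orbit \<sigma> ` S) + card (orbit (\<sigma> \<circ> \<alpha>) ` S))
      \<le> 4 * card (p ` S) + card {s\<in>S. \<alpha> s \<noteq> s}"
    using euler_inequality_labelling[OF finite bij_\<sigma> \<alpha>_in \<alpha>_\<alpha>] by auto
  obtain s where s: "s \<in> S" using nonempty by auto
  have "p t = p s" if "t \<in> S" for t
    by (rule invariant_constant[of p]) (use inv that s in simp_all)
  then have "p ` S \<subseteq> {p s}" by blast
  then have "card (p ` S) \<le> 1" using card_mono[of "{p s}" "p ` S"] by simp
  moreover have "{s\<in>S. \<alpha> s \<noteq> s} = S" using \<alpha>_neq by auto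
  ultimately show ?thesis using bound by simp
qed

lemma orbit_flip_flip:
  assumes "f ` S \<subseteq> S" and "s \<in> S"
  shows "orbit (f \<circ> \<alpha> \<circ> \<alpha>) s = orbit f s"
  using assms \<alpha>_\<alpha> by (intro orbit_cong0[symmetric, of s S]) auto

end

lemma sum_card_orbits:
  assumes "finite S" and "bij_betw f S S"
  shows "(\<Sum>c\<in>orbit f ` S. card c) = card S"
proof -
  have "of_nat (card (orbit f s)) / of_nat (card (orbit f s)) = (1 :: rat)" if "s \<in> S" for s
    using card_orbit_pos[OF self_in_orbit[OF assms that]] by simp
  then have "of_nat (card S)
      = (\<Sum>s\<in>S. of_nat (card (orbit f s)) / of_nat (card (orbit f s)) :: rat)"
    by simp
  also have "\<dots> = of_nat (\<Sum>c\<in>orbit f ` S. card c)"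
    using sum_over_orbits[OF assms, of "\<lambda>c. of_nat (card c)"] by simp
  finally show ?thesis by (simp only: of_nat_eq_iff)
qed

text \<open>
  An orbit whose length is a multiple of \<open>k\<close> has at least \<open>k\<close> elements, any other at least one.
\<close>

lemma card_orbits_le:
  assumes "finite S" and "bij_betw f S S" and "k > 0"
  shows "k * card (orbit f ` S) \<le> card S + (k - 1) * card {c \<in> orbit f ` S. \<not> k dvd card c}"
proof -
  have "k * card (orbit f ` S) = (\<Sum>c\<in>orbit f ` S. k)" by simp
  also have "\<dots> \<le> (\<Sum>c\<in>orbit f ` S. card c + (if k dvd card c then 0 else k - 1))"
  proof (rule sum_mono)
    fix c assume "c \<in> orbit f ` S"
    then obtain s where "s \<in> S" "c = orbit f s" by blast
    then have "card c > 0" using card_orbit_pos[OF self_in_orbit[OF assms(1,2)]] by simp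
    then show "k \<le> card c + (if k dvd card c then 0 else k - 1)"
      using assms(3) by (auto dest: dvd_imp_le)
  qed
  also have "\<dots> = card S + (k - 1) * card {c \<in> orbit f ` S. \<not> k dvd card c}"
    using assms(1)
    by (simp add: sum.distrib sum_card_orbits[OF assms(1,2)] sum.If_cases Int_def mult.commute)
  finally show ?thesis .
qed

text \<open>A map is spherical if its Euler characteristic is 2, here written without division.\<close>

locale spherical_map = connected_map +
  assumes spherical: "2 * (card (orbit \<sigma> ` S) + card (orbit (\<sigma> \<circ> \<alpha>) ` S)) = card S + 4"
begin

text \<open>
  Without exceptions there are at most \<open>M / k\<close> vertices and \<open>M / l\<close> faces, where \<open>M\<close> is the number of
  darts, and each exception raises these bounds by less than 1. In \<open>V + F = M / 2 + 2\<close> this leaves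
  \<open>M / 2 < M / k + M / l\<close>.
\<close>

lemma spherical_type:
  assumes "card {c \<in> orbit \<sigma> ` S. \<not> k dvd card c} + card {c \<in> orbit (\<sigma> \<circ> \<alpha>) ` S. \<not> l dvd card c} \<le> 2"
    and "k > 0" and "l > 0"
  shows "k * l < 2 * (k + l)"
proof (rule ccontr)
  define V where "V = int (card (orbit \<sigma> ` S))"
  define F where "F = int (card (orbit (\<sigma> \<circ> \<alpha>) ` S))"
  define M where "M = int (card S)"
  define a where "a = int (card {c \<in> orbit \<sigma> ` S. \<not> k dvd card c})"
  define b where "b = int (card {c \<in> orbit (\<sigma> \<circ> \<alpha>) ` S. \<not> l dvd card c})"
  define K where "K = int k"
  define L where "L = int l"
  have pos: "K > 0" "L > 0" "M > 0" "a \<ge> 0" "b \<ge> 0" "a + b \<le> 2"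
    using assms finite nonempty
    by (auto simp: K_def L_def M_def a_def b_def card_gt_0_iff)
  have "int (k * card (orbit \<sigma> ` S)) \<le> int (card S + (k - 1) * card {c \<in> orbit \<sigma> ` S. \<not> k dvd card c})"
    using card_orbits_le[OF finite bij_\<sigma> assms(2)] by (simp only: of_nat_le_iff)
  then have V: "K * V \<le> M + (K - 1) * a"
    using assms(2) by (simp add: K_def V_def M_def a_def of_nat_diff)
  have "int (l * card (orbit (\<sigma> \<circ> \<alpha>) ` S))
      \<le> int (card S + (l - 1) * card {c \<in> orbit (\<sigma> \<circ> \<alpha>) ` S. \<not> l dvd card c})"
    using card_orbits_le[OF finite bij_\<phi> assms(3)] by (simp only: of_nat_le_iff)
  then have F: "L * F \<le> M + (L - 1) * b"
    using assms(3) by (simp add: L_def F_def M_def b_def of_nat_diff)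
  have "int (2 * (card (orbit \<sigma> ` S) + card (orbit (\<sigma> \<circ> \<alpha>) ` S))) = int (card S + 4)"
    by (simp only: spherical)
  then have E: "2 * V + 2 * F = M + 4" by (simp add: V_def F_def M_def)
  assume "\<not> k * l < 2 * (k + l)"
  then have "int (2 * (k + l)) \<le> int (k * l)" by (simp only: of_nat_le_iff not_less)
  then have "M * (2 * K + 2 * L) \<le> M * (K * L)"
    using pos(3) by (intro mult_left_mono) (auto simp: K_def L_def)
  moreover have "2 * L * (K * V) + 2 * K * (L * F)
      \<le> 2 * L * (M + (K - 1) * a) + 2 * K * (M + (L - 1) * b)"
    using V F pos by (intro add_mono mult_left_mono) auto
  moreover have "2 * L * (K * V) + 2 * K * (L * F) = K * L * (2 * V + 2 * F)"
    by (simp add: algebra_simps)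
  ultimately have le: "2 * (K * L) * 2 + 2 * (L * a) + 2 * (K * b) \<le> 2 * (K * L) * (a + b)"
    unfolding E by (simp add: algebra_simps)
  have "0 < K * L" "0 \<le> L * a" "0 \<le> K * b" using pos by auto
  moreover have "2 * (K * L) * (a + b) \<le> 2 * (K * L) * 2"
    using pos by (intro mult_left_mono) auto
  ultimately have "L * a = 0" "K * b = 0" using le by linarith+
  then have "a = 0" "b = 0" using pos by auto
  then show False using le \<open>0 < K * L\<close> by simp
qed

end

text \<open>
  In a finite set, closure under a permutation implies closure under its inverse.
\<close>

lemma backward_closed:
  assumes "finite A" and "inj_on f K" and "A \<subseteq> K" and "f ` A \<subseteq> A" and "q \<in> K" and "f q \<in> A"
  shows "q \<in> A"
proof -
  have "f ` A = A"
    using assms by (intro card_subset_eq) (auto intro: card_image inj_on_subset)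
  then obtain r where "r \<in> A" "f q = f r" using assms(6) by auto
  then show ?thesis using assms by (metis inj_onD subsetD)
qed

text \<open>
  The permutations of \<open>K\<close> carry the fibre over \<open>s\<close> onto the fibre over the image of \<open>s\<close>, so that the
  size of the fibre is an invariant function on a connected map.
\<close>

lemma equivariant_fibres_constant:
  assumes "connected_map K \<sigma>' \<alpha>'" and "connected_map S \<sigma> \<alpha>"
    and "\<And>q. q \<in> K \<Longrightarrow> h q \<in> S"
    and "\<And>q. q \<in> K \<Longrightarrow> h (\<sigma>' q) = \<sigma> (h q)" and "\<And>q. q \<in> K \<Longrightarrow> h (\<alpha>' q) = \<alpha> (h q)"
  obtains N where "\<And>s. s \<in> S \<Longrightarrow> card {q \<in> K. h q = s} = N" and "card K = N * card S"
proof -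
  interpret K: connected_map K \<sigma>' \<alpha>' by fact
  interpret S: connected_map S \<sigma> \<alpha> by fact
  let ?c = "\<lambda>s. card {q \<in> K. h q = s}"
  have moves: "?c (f s) = ?c s"
    if move: "s \<in> S" "bij_betw f' K K" "bij_betw f S S" "\<And>q. q \<in> K \<Longrightarrow> h (f' q) = f (h q)" for f f' s
  proof -
    have "f' ` {q \<in> K. h q = s} = {q \<in> K. h q = f s}"
    proof (intro equalityI subsetI)
      fix r assume r: "r \<in> {q \<in> K. h q = f s}"
      then obtain q where q: "q \<in> K" "r = f' q" using move(2) by (auto simp: bij_betw_def)
      then have "f (h q) = f s" using r move by auto
      then have "h q = s" using move q assms(3) by (auto simp: bij_betw_def dest: inj_onD)
      then show "r \<in> f' ` {q \<in> K. h q = s}" using q by auto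
    qed (use move in \<open>auto simp: bij_betw_def\<close>)
    moreover have "inj_on f' {q \<in> K. h q = s}"
      using move(2) by (auto simp: bij_betw_def intro: inj_on_subset)
    ultimately show ?thesis using card_image[of f' "{q \<in> K. h q = s}"] by simp
  qed
  obtain s0 where s0: "s0 \<in> S" using S.nonempty by auto
  have const: "?c s = ?c s0" if "s \<in> S" for s
  proof (rule S.invariant_constant[of ?c])
    fix r assume r: "r \<in> S"
    show "?c (\<sigma> r) = ?c r" by (rule moves[OF r K.bij_\<sigma> S.bij_\<sigma> assms(4)])
    show "?c (\<alpha> r) = ?c r" by (rule moves[OF r K.bij_\<alpha> S.bij_\<alpha> assms(5)])
  qed (use that s0 in auto)
  have "card K = (\<Sum>s\<in>S. ?c s)"
    using sum.group[OF K.finite S.finite, of h "\<lambda>_. 1::nat"] assms(3)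
    by (simp add: image_subset_iff)
  also have "\<dots> = (\<Sum>s\<in>S. ?c s0)" by (rule sum.cong[OF refl const])
  finally show ?thesis using const by (intro that[of "?c s0"]) simp_all
qed

text \<open>
  On a finite set, closing under the two permutations alone gives an orbit of the group that they
  generate.
\<close>

inductive_set component :: "('a \<Rightarrow> 'a) \<Rightarrow> ('a \<Rightarrow> 'a) \<Rightarrow> 'a \<Rightarrow> 'a set" for \<sigma> \<alpha> p where
  base: "p \<in> component \<sigma> \<alpha> p"
| rot: "q \<in> component \<sigma> \<alpha> p \<Longrightarrow> \<sigma> q \<in> component \<sigma> \<alpha> p"
| flip: "q \<in> component \<sigma> \<alpha> p \<Longrightarrow> \<alpha> q \<in> component \<sigma> \<alpha> p"

lemma component_subset:
  assumes "p \<in> P" and "\<sigma> ` P \<subseteq> P" and "\<alpha> ` P \<subseteq> P"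
  shows "component \<sigma> \<alpha> p \<subseteq> P"
proof
  fix q assume "q \<in> component \<sigma> \<alpha> p"
  then show "q \<in> P" using assms by induction auto
qed

lemma connected_map_component:
  assumes "finite P" and "p \<in> P" and "bij_betw \<sigma> P P"
    and \<alpha>: "\<And>q. q \<in> P \<Longrightarrow> \<alpha> q \<in> P" "\<And>q. q \<in> P \<Longrightarrow> \<alpha> (\<alpha> q) = q" "\<And>q. q \<in> P \<Longrightarrow> \<alpha> q \<noteq> q"
  shows "connected_map (component \<sigma> \<alpha> p) \<sigma> \<alpha>"
proof
  let ?K = "component \<sigma> \<alpha> p"
  have sub: "?K \<subseteq> P"
    using assms by (intro component_subset) (auto simp: bij_betw_def)
  show fin: "finite ?K" using assms(1) sub by (rule finite_subset[rotated])
  show "?K \<noteq> {}" using component.base by fast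
  have inj: "inj_on \<sigma> ?K" using assms(3) sub by (auto simp: bij_betw_def intro: inj_on_subset)
  have "\<sigma> ` ?K \<subseteq> ?K" by (auto intro: component.rot)
  then show "bij_betw \<sigma> ?K ?K"
    using endo_inj_surj[OF fin _ inj] inj by (simp add: bij_betw_def)
  fix q assume "q \<in> ?K"
  then show "\<alpha> q \<in> ?K" "\<alpha> (\<alpha> q) = q" "\<alpha> q \<noteq> q"
    using \<alpha> sub by (auto intro: component.flip)
next
  let ?K = "component \<sigma> \<alpha> p"
  have sub: "?K \<subseteq> P"
    using assms by (intro component_subset) (auto simp: bij_betw_def)
  have inj: "inj_on \<sigma> P" using assms(3) by (simp add: bij_betw_def)
  fix A assume A: "A \<subseteq> ?K" "A \<noteq> {}" "\<sigma> ` A \<subseteq> A" "\<alpha> ` A \<subseteq> A"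
  have finA: "finite A" using A(1) sub assms(1) by (meson finite_subset)
  have "q \<in> A \<longrightarrow> p \<in> A" if "q \<in> ?K" for q
    using that
  proof induction
    case (rot q)
    then show ?case
      using backward_closed[OF finA inj, of q] A sub by blast
  next
    case (flip q)
    then show ?case using A \<alpha>(2)[of q] sub by (metis image_subset_iff subsetD)
  qed simp
  then have "p \<in> A" using A by blast
  then have "?K \<subseteq> A" using A(3,4) by (rule component_subset)
  then show "A = ?K" using A(1) by simp
qed

section \<open>Coverings with a Platonic map as fibre\<close>

text \<open>
  Constant degrees make the darts usable as the fibre of a covering: a power of \<open>x\<close>, or of the face
  permutation, that fixes one dart fixes all of them.
\<close>

locale regular_map = connected_map T x z
  for T :: "'t set" and x z :: "'t \<Rightarrow> 't" +
  fixes k l :: nat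
  assumes vertex_size: "t \<in> T \<Longrightarrow> card (orbit x t) = k"
    and face_size: "t \<in> T \<Longrightarrow> card (orbit (x \<circ> z) t) = l"
begin

lemma degrees_pos: "k > 0" "l > 0"
proof -
  obtain t where t: "t \<in> T" using nonempty by auto
  show "k > 0" using vertex_size[OF t] card_orbit_pos[OF self_in_orbit[OF finite bij_\<sigma> t]] by simp
  show "l > 0" using face_size[OF t] card_orbit_pos[OF self_in_orbit[OF finite bij_\<phi> t]] by simp
qed

lemma dual: "regular_map T (x \<circ> z) z l k"
proof unfold_locales
  show "finite T" "T \<noteq> {}" "bij_betw (x \<circ> z) T T" by (rule finite nonempty bij_\<phi>)+
  fix t assume t: "t \<in> T"
  show "z t \<in> T" "z (z t) = t" "z t \<noteq> t" using t by (rule \<alpha>_in \<alpha>_\<alpha> \<alpha>_neq)+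
  show "card (orbit (x \<circ> z) t) = l" using t by (rule face_size)
  have "orbit (x \<circ> z \<circ> z) t = orbit x t" using \<sigma>_in t by (intro orbit_flip_flip) auto
  then show "card (orbit (x \<circ> z \<circ> z) t) = k" using t vertex_size by simp
next
  fix A assume A: "A \<subseteq> T" "A \<noteq> {}" "(x \<circ> z) ` A \<subseteq> A" "z ` A \<subseteq> A"
  have "x a \<in> A" if "a \<in> A" for a
  proof -
    have "z a \<in> A" using A that by auto
    then have "(x \<circ> z) (z a) \<in> A" using A by blast
    then show ?thesis using \<alpha>_\<alpha> A that by auto
  qed
  then show "A = T" using A by (intro transitive) auto
qed

end

text \<open>
  The reciprocal of the order of the holonomy \<open>g ^ card c\<close> around an orbit \<open>c\<close>, when \<open>g\<close> has
  order \<open>k\<close>. It is 1 exactly when the orbit is not exceptional.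
\<close>

definition holonomy_weight :: "nat \<Rightarrow> 'a set \<Rightarrow> rat" where
  "holonomy_weight k c = of_nat (gcd (card c) k) / of_nat k"

lemma holonomy_weight_eq_1: "k > 0 \<Longrightarrow> k dvd card c \<Longrightarrow> holonomy_weight k c = 1"
  by (simp add: holonomy_weight_def gcd_nat.absorb2)

lemma holonomy_weight_less_1:
  assumes "k > 0" and "\<not> k dvd card c"
  shows "holonomy_weight k c < 1"
proof -
  have "gcd (card c) k < k"
    using assms by (metis gcd_dvd1 gcd_le2_nat le_neq_implies_less neq0_conv)
  then show ?thesis using assms(1) by (simp add: holonomy_weight_def)
qed

text \<open>
  A pair \<open>(d, t)\<close> lies in an orbit of length \<open>lcm u k\<close>, where \<open>u\<close> is the length of the orbit \<open>c\<close> of \<open>d\<close>.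
  Over \<open>c\<close> there are \<open>N u\<close> pairs, hence \<open>N u / lcm u k = N gcd u k / k\<close> orbits.
\<close>

lemma card_orbits_covering:
  fixes f :: "'d \<Rightarrow> 'd" and g :: "'t \<Rightarrow> 't"
  assumes "finite D" and "bij_betw f D D"
    and g: "finite T" "bij_betw g T T" "\<And>t. t \<in> T \<Longrightarrow> card (orbit g t) = k" "k > 0"
    and K: "K \<subseteq> D \<times> T" "bij_betw (map_prod f g) K K"
    and N: "\<And>d. d \<in> D \<Longrightarrow> card {q \<in> K. fst q = d} = N"
  shows "of_nat (card (orbit (map_prod f g) ` K)) = of_nat N * (\<Sum>c\<in>orbit f ` D. holonomy_weight k c)"
proof -
  let ?h = "\<lambda>d. holonomy_weight k (orbit f d) / of_nat (card (orbit f d))"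
  have finK: "finite K" using K(1) assms(1) g(1) by (meson finite_SigmaI finite_subset)
  have summand: "1 / of_nat (card (orbit (map_prod f g) q)) = ?h (fst q)" if qK: "q \<in> K" for q
  proof -
    obtain d t where q: "q = (d, t)" "d \<in> D" "t \<in> T" using qK K(1) by auto
    let ?u = "card (orbit f d)"
    have self: "d \<in> orbit f d" "t \<in> orbit g t"
      using q assms g by (auto intro: self_in_orbit)
    have u: "?u > 0" using self(1) by (rule card_orbit_pos)
    have card: "card (orbit (map_prod f g) q) = lcm ?u k"
      using card_orbit_map_prod[OF self] q g by simp
    have "of_nat (lcm ?u k) * of_nat (gcd ?u k) = (of_nat (?u * k) :: rat)"
      by (metis of_nat_mult prod_gcd_lcm_nat mult.commute)
    moreover have "lcm ?u k > 0" using u g(4) by (simp add: lcm_pos_nat)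
    ultimately show ?thesis
      unfolding card using u g(4) unfolding holonomy_weight_def q by (simp add: field_simps)
  qed
  have "of_nat (card (orbit (map_prod f g) ` K))
      = (\<Sum>q\<in>K. 1 / of_nat (card (orbit (map_prod f g) q)) :: rat)"
    using sum_over_orbits[OF finK K(2), of "\<lambda>_. 1"] by simp
  also have "\<dots> = (\<Sum>q\<in>K. ?h (fst q))" using summand by simp
  also have "\<dots> = (\<Sum>d\<in>D. \<Sum>q\<in>{q \<in> K. fst q = d}. ?h (fst q))"
    by (rule sum.group[OF finK assms(1), symmetric]) (use K(1) in auto)
  also have "\<dots> = (\<Sum>d\<in>D. of_nat N * ?h d)"
  proof (rule sum.cong[OF refl])
    fix d assume "d \<in> D"
    have "(\<Sum>q\<in>{q \<in> K. fst q = d}. ?h (fst q)) = (\<Sum>q\<in>{q \<in> K. fst q = d}. ?h d)"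
      by (rule sum.cong) simp_all
    then show "(\<Sum>q\<in>{q \<in> K. fst q = d}. ?h (fst q)) = of_nat N * ?h d"
      using N[OF \<open>d \<in> D\<close>] by simp
  qed
  also have "\<dots> = of_nat N * (\<Sum>c\<in>orbit f ` D. holonomy_weight k c)"
    using sum_over_orbits[OF assms(1,2), of "holonomy_weight k"]
    unfolding sum_distrib_left[symmetric] by simp
  finally show ?thesis .
qed

text \<open>
  Going once around the orbit of \<open>d\<close> returns to \<open>d\<close> and applies \<open>g\<close> once for each step.
\<close>

lemma holonomy_in_fibre:
  fixes f :: "'d \<Rightarrow> 'd" and g :: "'t \<Rightarrow> 't"
  assumes "d \<in> orbit f d" and "t \<in> orbit g t"
    and "(d, t) \<in> K" and "map_prod f g ` K \<subseteq> K"
  shows "orbit (g ^^ card (orbit f d)) t \<subseteq> {s. (d, s) \<in> K}"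
proof
  let ?u = "card (orbit f d)"
  have iter: "(map_prod f g ^^ n) (d, t) \<in> K" for n
    using assms(3,4) by (induction n) auto
  fix s assume "s \<in> orbit (g ^^ ?u) t"
  then obtain n where n: "s = (g ^^ (?u * n)) t" by (auto simp: orbit_altdef funpow_mult)
  have "(f ^^ (?u * n)) d = d" using funpow_fixes_iff[OF assms(1)] by simp
  then show "s \<in> {s. (d, s) \<in> K}" using iter[of "?u * n"] n by (simp add: map_prod_funpow)
qed

text \<open>
  The fibre over \<open>d\<close> contains an orbit of the holonomy around \<open>d\<close>. This bounds its size from below,
  and if the bound is attained, the fibre is just this orbit.
\<close>

lemma fibre_and_holonomy:
  fixes f :: "'d \<Rightarrow> 'd" and g :: "'t \<Rightarrow> 't"
  assumes "d \<in> orbit f d" and "t \<in> orbit g t" and "card (orbit g t) = k"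
    and "(d, t) \<in> K" and "map_prod f g ` K \<subseteq> K" and "finite K" and "card {q \<in> K. fst q = d} = N"
  shows "1 \<le> of_nat N * holonomy_weight k (orbit f d)"
    and "of_nat N * holonomy_weight k (orbit f d) = 1 \<Longrightarrow> (d, s) \<in> K \<Longrightarrow> s \<in> orbit g t"
proof -
  let ?u = "card (orbit f d)" and ?F = "{s. (d, s) \<in> K}"
  let ?O = "orbit (g ^^ card (orbit f d)) t"
  have "{q \<in> K. fst q = d} = Pair d ` ?F" by auto
  then have F: "card ?F = N" using assms(7) by (simp add: card_image inj_on_def)
  have "?F \<subseteq> snd ` K" by force
  then have finF: "finite ?F" using assms(6) by (meson finite_imageI finite_subset)
  have sub: "?O \<subseteq> ?F" by (rule holonomy_in_fibre[OF assms(1,2,4,5)])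
  have O: "card ?O * gcd ?u k = k"
    using card_orbit_funpow[OF assms(2), of ?u] assms(3) by simp
  have k: "k > 0" using card_orbit_pos[OF assms(2)] assms(3) by simp
  have "card ?O \<le> N" using sub finF F card_mono by metis
  then have "k \<le> N * gcd ?u k" using O by (metis mult_le_mono1)
  then have "of_nat k \<le> (of_nat (N * gcd ?u k) :: rat)" by (simp only: of_nat_le_iff)
  then show "1 \<le> of_nat N * holonomy_weight k (orbit f d)"
    using k by (simp add: holonomy_weight_def field_simps)
  assume "of_nat N * holonomy_weight k (orbit f d) = 1" and s: "(d, s) \<in> K"
  then have "of_nat (N * gcd ?u k) = (of_nat k :: rat)"
    using k by (simp add: holonomy_weight_def field_simps)
  then have "N * gcd ?u k = card ?O * gcd ?u k" using O by (simp only: of_nat_eq_iff)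
  then have "card ?O = N" using k by simp
  then have "?O = ?F" using card_subset_eq[OF finF sub] F by simp
  then show "s \<in> orbit g t" using s orbit_funpow_subset[OF assms(2)] by auto
qed

lemma holonomy_weight_1_iff:
  assumes "m > 0"
  shows "of_nat N * holonomy_weight m c = 1 \<longleftrightarrow> N * gcd (card c) m = m"
proof -
  have "of_nat N * holonomy_weight m c = of_nat (N * gcd (card c) m) / of_nat m"
    by (simp add: holonomy_weight_def)
  also have "\<dots> = 1 \<longleftrightarrow> (of_nat (N * gcd (card c) m) :: rat) = of_nat m"
    using assms by auto
  finally show ?thesis by (simp only: of_nat_eq_iff)
qed

lemma equality_case:
  fixes a b :: rat
  assumes "of_nat N * (a + b) \<le> 2" and "1 \<le> of_nat N * a" and "1 \<le> of_nat N * b"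
  shows "of_nat N * a = 1" and "of_nat N * b = 1"
  using assms by (auto simp: algebra_simps)

locale platonic_covering =
  D: spherical_map D \<sigma> \<alpha> + T: regular_map T x z k l
  for D :: "'d set" and \<sigma> \<alpha> and T :: "'t set" and x z k l
begin

text \<open>
  The covering is the component of \<open>(d0, t0)\<close> in the product of the two maps. The bound is the Euler
  inequality for this component, and the divisibility comes from its projection to the fibre.
\<close>

lemma exists_cover:
  assumes "d0 \<in> D" and "t0 \<in> T"
  obtains K N where
    "(d0, t0) \<in> K"
    and "card T dvd N * card D"
    and "map_prod \<sigma> x ` K \<subseteq> K" and "map_prod \<alpha> z ` K \<subseteq> K"
    and "of_nat N * ((\<Sum>c\<in>orbit \<sigma> ` D. holonomy_weight k c)
        + (\<Sum>c\<in>orbit (\<sigma> \<circ> \<alpha>) ` D. holonomy_weight l c) - of_nat (card D) / 2) \<le> 2"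
    and "\<And>d. d \<in> D \<Longrightarrow> 1 \<le> of_nat N * holonomy_weight k (orbit \<sigma> d)"
    and "\<And>d. d \<in> D \<Longrightarrow> 1 \<le> of_nat N * holonomy_weight l (orbit (\<sigma> \<circ> \<alpha>) d)"
    and "\<And>d t s. \<lbrakk>(d, t) \<in> K; (d, s) \<in> K; of_nat N * holonomy_weight k (orbit \<sigma> d) = 1\<rbrakk>
        \<Longrightarrow> s \<in> orbit x t"
    and "\<And>d t s. \<lbrakk>(d, t) \<in> K; (d, s) \<in> K; of_nat N * holonomy_weight l (orbit (\<sigma> \<circ> \<alpha>) d) = 1\<rbrakk>
        \<Longrightarrow> s \<in> orbit (x \<circ> z) t"
proof -
  let ?\<sigma> = "map_prod \<sigma> x" and ?\<alpha> = "map_prod \<alpha> z"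
  define K where "K = component ?\<sigma> ?\<alpha> (d0, t0)"
  have bij: "bij_betw ?\<sigma> (D \<times> T) (D \<times> T)"
    using D.bij_\<sigma> T.bij_\<sigma> by (rule bij_betw_map_prod)
  have sub: "K \<subseteq> D \<times> T"
    unfolding K_def using assms D.\<sigma>_in T.\<sigma>_in D.\<alpha>_in T.\<alpha>_in by (intro component_subset) auto
  have K: "connected_map K ?\<sigma> ?\<alpha>"
    unfolding K_def
    using assms D.finite T.finite bij D.\<alpha>_in T.\<alpha>_in D.\<alpha>_\<alpha> T.\<alpha>_\<alpha> D.\<alpha>_neq
    by (intro connected_map_component[of "D \<times> T"]) auto
  interpret K: connected_map K ?\<sigma> ?\<alpha> by (rule K)
  obtain N where N: "\<And>d. d \<in> D \<Longrightarrow> card {q \<in> K. fst q = d} = N" "card K = N * card D"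
    using K D.connected_map_axioms by (rule equivariant_fibres_constant[of K _ _ D \<sigma> \<alpha> fst]) (use sub in auto)
  obtain M where "card K = M * card T"
    using K T.connected_map_axioms by (rule equivariant_fibres_constant[of K _ _ T x z snd]) (use sub in auto)
  then have dvd: "card T dvd N * card D" using N(2) by simp
  have base: "(d0, t0) \<in> K" unfolding K_def by (rule component.base)
  have rot: "?\<sigma> ` K \<subseteq> K"
    unfolding K_def by (intro image_subsetI component.rot)
  have flip: "?\<alpha> ` K \<subseteq> K"
    unfolding K_def by (intro image_subsetI component.flip)
  have comp: "map_prod (\<sigma> \<circ> \<alpha>) (x \<circ> z) = ?\<sigma> \<circ> ?\<alpha>" by auto
  then have face: "map_prod (\<sigma> \<circ> \<alpha>) (x \<circ> z) ` K \<subseteq> K" using rot flip by (auto simp: image_comp[symmetric] simp del: map_prod_simp)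
  have "N > 0" using N(2) K.finite base by (cases N) auto
  have V: "of_nat (card (orbit ?\<sigma> ` K)) = of_nat N * (\<Sum>c\<in>orbit \<sigma> ` D. holonomy_weight k c)"
    by (rule card_orbits_covering[OF D.finite D.bij_\<sigma> T.finite T.bij_\<sigma> T.vertex_size
          T.degrees_pos(1) sub K.bij_\<sigma> N(1)])
  have F: "of_nat (card (orbit (?\<sigma> \<circ> ?\<alpha>) ` K))
      = of_nat N * (\<Sum>c\<in>orbit (\<sigma> \<circ> \<alpha>) ` D. holonomy_weight l c)"
    using card_orbits_covering[OF D.finite D.bij_\<phi> T.finite T.bij_\<phi> T.face_size
          T.degrees_pos(2) sub _ N(1)] K.bij_\<phi> comp by simp
  have "of_nat (2 * (card (orbit ?\<sigma> ` K) + card (orbit (?\<sigma> \<circ> ?\<alpha>) ` K))) \<le> (of_nat (card K + 4) :: rat)"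
    using K.euler_inequality by (simp only: of_nat_le_iff)
  then have euler: "of_nat N * ((\<Sum>c\<in>orbit \<sigma> ` D. holonomy_weight k c)
        + (\<Sum>c\<in>orbit (\<sigma> \<circ> \<alpha>) ` D. holonomy_weight l c) - of_nat (card D) / 2) \<le> 2"
    using V F N(2) by (simp add: algebra_simps)
  have fibre_\<sigma>: "1 \<le> of_nat N * holonomy_weight k (orbit \<sigma> d)"
    "of_nat N * holonomy_weight k (orbit \<sigma> d) = 1 \<Longrightarrow> (d, s) \<in> K \<Longrightarrow> s \<in> orbit x t"
    if "(d, t) \<in> K" for d t s
  proof -
    have dt: "d \<in> D" "t \<in> T" using that sub by auto
    note * = self_in_orbit[OF D.finite D.bij_\<sigma> dt(1)] self_in_orbit[OF T.finite T.bij_\<sigma> dt(2)]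
      T.vertex_size[OF dt(2)] that rot K.finite N(1)[OF dt(1)]
    show "1 \<le> of_nat N * holonomy_weight k (orbit \<sigma> d)"
      "of_nat N * holonomy_weight k (orbit \<sigma> d) = 1 \<Longrightarrow> (d, s) \<in> K \<Longrightarrow> s \<in> orbit x t"
      by (rule fibre_and_holonomy[OF *], assumption?)+
  qed
  have fibre_\<phi>: "1 \<le> of_nat N * holonomy_weight l (orbit (\<sigma> \<circ> \<alpha>) d)"
    "of_nat N * holonomy_weight l (orbit (\<sigma> \<circ> \<alpha>) d) = 1 \<Longrightarrow> (d, s) \<in> K \<Longrightarrow> s \<in> orbit (x \<circ> z) t"
    if "(d, t) \<in> K" for d t s
  proof -
    have dt: "d \<in> D" "t \<in> T" using that sub by auto
    note * = self_in_orbit[OF D.finite D.bij_\<phi> dt(1)] self_in_orbit[OF T.finite T.bij_\<phi> dt(2)]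
      T.face_size[OF dt(2)] that face K.finite N(1)[OF dt(1)]
    show "1 \<le> of_nat N * holonomy_weight l (orbit (\<sigma> \<circ> \<alpha>) d)"
      "of_nat N * holonomy_weight l (orbit (\<sigma> \<circ> \<alpha>) d) = 1 \<Longrightarrow> (d, s) \<in> K \<Longrightarrow> s \<in> orbit (x \<circ> z) t"
      by (rule fibre_and_holonomy[OF *], assumption?)+
  qed
  have over: "\<exists>t. (d, t) \<in> K" if "d \<in> D" for d
  proof -
    have "{q \<in> K. fst q = d} \<noteq> {}" using N(1)[OF that] \<open>N > 0\<close> by (metis card.empty less_irrefl)
    then show ?thesis by auto
  qed
  show ?thesis
  proof (rule that[of K N])
    show "1 \<le> of_nat N * holonomy_weight k (orbit \<sigma> d)" if "d \<in> D" for d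
      using over[OF that] fibre_\<sigma>(1) by blast
    show "1 \<le> of_nat N * holonomy_weight l (orbit (\<sigma> \<circ> \<alpha>) d)" if "d \<in> D" for d
      using over[OF that] fibre_\<phi>(1) by blast
  qed (use base dvd rot flip euler fibre_\<sigma>(2) fibre_\<phi>(2) in auto)
qed

lemma \<phi>_closed:
  assumes "map_prod \<sigma> x ` K \<subseteq> K" and "map_prod \<alpha> z ` K \<subseteq> K"
  shows "map_prod (\<sigma> \<circ> \<alpha>) (x \<circ> z) ` K \<subseteq> K"
  using assms by (force simp: image_subset_iff)

abbreviation "ramified_vertices \<equiv> {c \<in> orbit \<sigma> ` D. \<not> k dvd card c}"
abbreviation "ramified_faces \<equiv> {c \<in> orbit (\<sigma> \<circ> \<alpha>) ` D. \<not> l dvd card c}"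

text \<open>
  By sphericity only the ramified vertices and faces contribute to the Euler characteristic of the
  covering, which is \<open>N\<close> times the left hand side.
\<close>

lemma sum_holonomy_weight:
  "(\<Sum>c\<in>orbit \<sigma> ` D. holonomy_weight k c) + (\<Sum>c\<in>orbit (\<sigma> \<circ> \<alpha>) ` D. holonomy_weight l c)
      - of_nat (card D) / 2
    = 2 - (\<Sum>c\<in>ramified_vertices. 1 - holonomy_weight k c) - (\<Sum>c\<in>ramified_faces. 1 - holonomy_weight l c)"
proof -
  have split: "(\<Sum>c\<in>C. holonomy_weight m c)
      = of_nat (card C) - (\<Sum>c\<in>{c \<in> C. \<not> m dvd card c}. 1 - holonomy_weight m c)"
    if "finite C" "m > 0" for C :: "'d set set" and m
  proof -
    have "(\<Sum>c\<in>{c \<in> C. \<not> m dvd card c}. 1 - holonomy_weight m c) = (\<Sum>c\<in>C. 1 - holonomy_weight m c)"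
      using that by (intro sum.mono_neutral_left) (auto simp: holonomy_weight_eq_1)
    then show ?thesis by (simp add: sum_subtractf)
  qed
  have "of_nat (2 * (card (orbit \<sigma> ` D) + card (orbit (\<sigma> \<circ> \<alpha>) ` D))) = (of_nat (card D + 4) :: rat)"
    using D.spherical by (simp only:)
  then show ?thesis
    using split[of "orbit \<sigma> ` D" k] split[of "orbit (\<sigma> \<circ> \<alpha>) ` D" l] D.finite T.degrees_pos
    by simp
qed

text \<open>
  A single ramified vertex or face of weight \<open>w < 1\<close> would give \<open>N (1 + w) \<le> 2\<close> and \<open>N w \<ge> 1\<close>, hence
  \<open>N \<le> 1 < 1 / w \<le> N\<close>.
\<close>

lemma not_one_exception: "card ramified_vertices + card ramified_faces \<noteq> 1"
proof
  assume one: "card ramified_vertices + card ramified_faces = 1"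
  have no_one: False
    if "of_nat N * (1 + w) \<le> (2::rat)" "1 \<le> of_nat N * w" "w < 1" for N :: nat and w
  proof -
    have "of_nat N \<le> (1::rat)" using that by (simp add: algebra_simps)
    then have "N = 0 \<or> N = 1" by auto
    then show False using that by auto
  qed
  obtain d t where dt: "d \<in> D" "t \<in> T" using D.nonempty T.nonempty by auto
  from dt obtain K N where
    le: "of_nat N * ((\<Sum>c\<in>orbit \<sigma> ` D. holonomy_weight k c)
        + (\<Sum>c\<in>orbit (\<sigma> \<circ> \<alpha>) ` D. holonomy_weight l c) - of_nat (card D) / 2) \<le> 2" and
    v: "\<And>d. d \<in> D \<Longrightarrow> 1 \<le> of_nat N * holonomy_weight k (orbit \<sigma> d)" and
    f: "\<And>d. d \<in> D \<Longrightarrow> 1 \<le> of_nat N * holonomy_weight l (orbit (\<sigma> \<circ> \<alpha>) d)"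
    by (rule exists_cover) blast
  note le = le[unfolded sum_holonomy_weight]
  from one consider "card ramified_vertices = 1" "card ramified_faces = 0"
    | "card ramified_vertices = 0" "card ramified_faces = 1" by linarith
  then show False
  proof cases
    case 1
    then obtain c where c: "ramified_vertices = {c}" by (auto simp: card_1_singleton_iff)
    then have "c \<in> ramified_vertices" by simp
    then have "1 \<le> of_nat N * holonomy_weight k c" "holonomy_weight k c < 1"
      using v T.degrees_pos by (auto intro: holonomy_weight_less_1)
    moreover have empty: "ramified_faces = {}" using 1 D.finite by simp
    have "of_nat N * (1 + holonomy_weight k c) \<le> 2"
      using le unfolding c empty by simp
    ultimately show False using no_one by blast
  next
    case 2
    then obtain c where c: "ramified_faces = {c}" by (auto simp: card_1_singleton_iff)
    then have "c \<in> ramified_faces" by simp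
    then have "1 \<le> of_nat N * holonomy_weight l c" "holonomy_weight l c < 1"
      using f T.degrees_pos by (auto intro: holonomy_weight_less_1)
    moreover have empty: "ramified_vertices = {}" using 2 D.finite by simp
    have "of_nat N * (1 + holonomy_weight l c) \<le> 2"
      using le unfolding c empty by simp
    ultimately show False using no_one by blast
  qed
qed

text \<open>
  The Euler inequality forces the number of sheets to be the branching order over both faces. For
  the second statement, start over \<open>d\<close> in the dart \<open>t\<close>, cross the edge, turn once around \<open>g\<close>, and cross the
  edge back. The dart reached lies over \<open>d\<close> again, and therefore on the Platonic face of \<open>t\<close>.
\<close>

lemma two_exceptional_faces:
  assumes "ramified_vertices = {}" and "ramified_faces = {f, g}" and "f \<noteq> g"
  shows "\<exists>N. N * gcd (card f) l = l \<and> N * gcd (card g) l = l \<and> card T dvd N * card D"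
    and "\<lbrakk>d \<in> f; \<alpha> d \<in> g; t \<in> T\<rbrakk>
      \<Longrightarrow> \<exists>w \<in> orbit (x \<circ> z) (z t). w \<noteq> z t \<and> z w \<in> orbit (x \<circ> z) t"
proof -
  have cover: "\<exists>K N. (d, t) \<in> K \<and> map_prod \<sigma> x ` K \<subseteq> K \<and> map_prod \<alpha> z ` K \<subseteq> K
      \<and> N * gcd (card f) l = l \<and> N * gcd (card g) l = l \<and> card T dvd N * card D
      \<and> (\<forall>s. (d, s) \<in> K \<and> orbit (\<sigma> \<circ> \<alpha>) d = f \<longrightarrow> s \<in> orbit (x \<circ> z) t)"
    if "d \<in> D" "t \<in> T" for d t
  proof -
    from that obtain K N where K: "(d, t) \<in> K" "map_prod \<sigma> x ` K \<subseteq> K" "map_prod \<alpha> z ` K \<subseteq> K" and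
      dvd: "card T dvd N * card D" and
      le: "of_nat N * ((\<Sum>c\<in>orbit \<sigma> ` D. holonomy_weight k c)
        + (\<Sum>c\<in>orbit (\<sigma> \<circ> \<alpha>) ` D. holonomy_weight l c) - of_nat (card D) / 2) \<le> 2" and
      ge: "\<And>d. d \<in> D \<Longrightarrow> 1 \<le> of_nat N * holonomy_weight l (orbit (\<sigma> \<circ> \<alpha>) d)" and
      fibre: "\<And>d t s. \<lbrakk>(d, t) \<in> K; (d, s) \<in> K; of_nat N * holonomy_weight l (orbit (\<sigma> \<circ> \<alpha>) d) = 1\<rbrakk>
        \<Longrightarrow> s \<in> orbit (x \<circ> z) t"
      by (rule exists_cover) blast
    have "f \<in> ramified_faces" "g \<in> ramified_faces" using assms(2) by auto
    then have "1 \<le> of_nat N * holonomy_weight l f" "1 \<le> of_nat N * holonomy_weight l g"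
      using ge by auto
    moreover have "of_nat N * (holonomy_weight l f + holonomy_weight l g) \<le> 2"
      using le assms(3) unfolding sum_holonomy_weight assms(1,2) by simp
    ultimately have w: "of_nat N * holonomy_weight l f = 1" "of_nat N * holonomy_weight l g = 1"
      using equality_case by blast+
    then have gcds: "N * gcd (card f) l = l" "N * gcd (card g) l = l"
      using holonomy_weight_1_iff T.degrees_pos(2) by blast+
    have "\<forall>s. (d, s) \<in> K \<and> orbit (\<sigma> \<circ> \<alpha>) d = f \<longrightarrow> s \<in> orbit (x \<circ> z) t"
      using fibre[OF K(1)] w(1) by auto
    then show ?thesis by (intro exI[of _ K] exI[of _ N] conjI K gcds dvd)
  qed
  show "\<exists>N. N * gcd (card f) l = l \<and> N * gcd (card g) l = l \<and> card T dvd N * card D"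
    using cover D.nonempty T.nonempty by blast
  assume adj: "d \<in> f" "\<alpha> d \<in> g" and t: "t \<in> T"
  have "f \<in> ramified_faces" "g \<in> ramified_faces" using assms(2) by auto
  then have fg: "f \<in> orbit (\<sigma> \<circ> \<alpha>) ` D" "g \<in> orbit (\<sigma> \<circ> \<alpha>) ` D" by blast+
  note d = orbit_of_member[OF D.finite D.bij_\<phi> fg(1) adj(1)]
  note \<alpha>d = orbit_of_member[OF D.finite D.bij_\<phi> fg(2) adj(2)]
  obtain K N where K: "(d, t) \<in> K" "map_prod \<sigma> x ` K \<subseteq> K" "map_prod \<alpha> z ` K \<subseteq> K"
    and fibre: "\<And>s. (d, s) \<in> K \<Longrightarrow> s \<in> orbit (x \<circ> z) t"
    using cover[OF d(1) t] d(2) by blast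
  let ?h = "(x \<circ> z) ^^ card g"
  have zt: "z t \<in> T" using t by (rule T.\<alpha>_in)
  note self = self_in_orbit[OF T.finite T.bij_\<phi> zt]
  have "(\<alpha> d, z t) \<in> K" using K by force
  then have "(\<alpha> d, ?h (z t)) \<in> K"
    using holonomy_in_fibre[OF self_in_orbit[OF D.finite D.bij_\<phi> \<alpha>d(1)] self _ \<phi>_closed[OF K(2,3)]]
      orbit.base[of ?h "z t"] \<alpha>d(2) by blast
  then have "(\<alpha> (\<alpha> d), z (?h (z t))) \<in> K" using K(3) by force
  then have "z (?h (z t)) \<in> orbit (x \<circ> z) t" using fibre D.\<alpha>_\<alpha>[OF d(1)] by simp
  moreover have "?h (z t) \<noteq> z t"
    using funpow_fixes_iff[OF self, of "card g"] T.face_size[OF zt] \<open>g \<in> ramified_faces\<close> by simp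
  moreover have "?h (z t) \<in> orbit (x \<circ> z) (z t)" using self by (rule funpow_in_orbit)
  ultimately show "\<exists>w \<in> orbit (x \<circ> z) (z t). w \<noteq> z t \<and> z w \<in> orbit (x \<circ> z) t" by blast
qed

text \<open>
  For the second statement, turning once around \<open>f\<close> leads from \<open>t\<close> to a dart in the fibre over \<open>d\<close>, and
  this fibre is contained in the Platonic vertex of \<open>t\<close>.
\<close>

lemma exceptional_vertex_and_face:
  assumes "ramified_vertices = {v}" and "ramified_faces = {f}"
  shows "\<exists>N. N * gcd (card v) k = k \<and> N * gcd (card f) l = l \<and> card T dvd N * card D"
    and "\<lbrakk>d \<in> v; d \<in> f; t \<in> T\<rbrakk> \<Longrightarrow> \<exists>w \<in> orbit x t \<inter> orbit (x \<circ> z) t. w \<noteq> t"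
proof -
  have cover: "\<exists>K N. (d, t) \<in> K \<and> map_prod \<sigma> x ` K \<subseteq> K \<and> map_prod \<alpha> z ` K \<subseteq> K
      \<and> N * gcd (card v) k = k \<and> N * gcd (card f) l = l \<and> card T dvd N * card D
      \<and> (\<forall>s. (d, s) \<in> K \<and> orbit \<sigma> d = v \<longrightarrow> s \<in> orbit x t)"
    if "d \<in> D" "t \<in> T" for d t
  proof -
    from that obtain K N where K: "(d, t) \<in> K" "map_prod \<sigma> x ` K \<subseteq> K" "map_prod \<alpha> z ` K \<subseteq> K" and
      dvd: "card T dvd N * card D" and
      le: "of_nat N * ((\<Sum>c\<in>orbit \<sigma> ` D. holonomy_weight k c)
        + (\<Sum>c\<in>orbit (\<sigma> \<circ> \<alpha>) ` D. holonomy_weight l c) - of_nat (card D) / 2) \<le> 2" and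
      ge: "\<And>d. d \<in> D \<Longrightarrow> 1 \<le> of_nat N * holonomy_weight k (orbit \<sigma> d)"
        "\<And>d. d \<in> D \<Longrightarrow> 1 \<le> of_nat N * holonomy_weight l (orbit (\<sigma> \<circ> \<alpha>) d)" and
      fibre: "\<And>d t s. \<lbrakk>(d, t) \<in> K; (d, s) \<in> K; of_nat N * holonomy_weight k (orbit \<sigma> d) = 1\<rbrakk>
        \<Longrightarrow> s \<in> orbit x t"
      by (rule exists_cover) blast
    have "v \<in> ramified_vertices" "f \<in> ramified_faces" using assms by auto
    then have "1 \<le> of_nat N * holonomy_weight k v" "1 \<le> of_nat N * holonomy_weight l f"
      using ge by auto
    moreover have "of_nat N * (holonomy_weight k v + holonomy_weight l f) \<le> 2"
      using le unfolding sum_holonomy_weight assms by simp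
    ultimately have w: "of_nat N * holonomy_weight k v = 1" "of_nat N * holonomy_weight l f = 1"
      using equality_case by blast+
    then have gcds: "N * gcd (card v) k = k" "N * gcd (card f) l = l"
      using holonomy_weight_1_iff T.degrees_pos by blast+
    have "\<forall>s. (d, s) \<in> K \<and> orbit \<sigma> d = v \<longrightarrow> s \<in> orbit x t"
      using fibre[OF K(1)] w(1) by auto
    then show ?thesis by (intro exI[of _ K] exI[of _ N] conjI K gcds dvd)
  qed
  show "\<exists>N. N * gcd (card v) k = k \<and> N * gcd (card f) l = l \<and> card T dvd N * card D"
    using cover D.nonempty T.nonempty by blast
  assume inc: "d \<in> v" "d \<in> f" and t: "t \<in> T"
  have "v \<in> ramified_vertices" "f \<in> ramified_faces" using assms by auto
  then have vf: "v \<in> orbit \<sigma> ` D" "f \<in> orbit (\<sigma> \<circ> \<alpha>) ` D" by blast+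
  note d = orbit_of_member[OF D.finite D.bij_\<sigma> vf(1) inc(1)]
    orbit_of_member(2)[OF D.finite D.bij_\<phi> vf(2) inc(2)]
  obtain K N where K: "(d, t) \<in> K" "map_prod \<sigma> x ` K \<subseteq> K" "map_prod \<alpha> z ` K \<subseteq> K"
    and fibre: "\<And>s. (d, s) \<in> K \<Longrightarrow> s \<in> orbit x t"
    using cover[OF d(1) t] d(2) by blast
  let ?h = "(x \<circ> z) ^^ card f"
  note self = self_in_orbit[OF T.finite T.bij_\<phi> t]
  have "(d, ?h t) \<in> K"
    using holonomy_in_fibre[OF self_in_orbit[OF D.finite D.bij_\<phi> d(1)] self K(1) \<phi>_closed[OF K(2,3)]]
      orbit.base[of ?h t] d(3) by blast
  then have "?h t \<in> orbit x t" by (rule fibre)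
  moreover have "?h t \<noteq> t"
    using funpow_fixes_iff[OF self, of "card f"] T.face_size[OF t] \<open>f \<in> ramified_faces\<close> by simp
  moreover have "?h t \<in> orbit (x \<circ> z) t" using self by (rule funpow_in_orbit)
  ultimately show "\<exists>w \<in> orbit x t \<inter> orbit (x \<circ> z) t. w \<noteq> t" by blast
qed

end

section \<open>The Platonic maps\<close>

text \<open>
  Maps with all faces of degree \<open>l\<close>: the dart \<open>(i, j)\<close> is the \<open>j\<close>-th dart on the boundary walk of
  face \<open>i\<close>. Such a map is given by its number of faces and the reversal of darts.
\<close>

definition darts :: "nat \<Rightarrow> nat \<Rightarrow> (nat \<times> nat) set" where
  "darts F l = {..<F} \<times> {..<l}"

definition face_step :: "nat \<Rightarrow> nat \<times> nat \<Rightarrow> nat \<times> nat" where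
  "face_step l t = (fst t, Suc (snd t) mod l)"

lemma face_step_funpow: "snd t < l \<Longrightarrow> (face_step l ^^ n) t = (fst t, (snd t + n) mod l)"
  by (induction n) (simp_all add: face_step_def mod_Suc_eq prod_eq_iff)

lemma funpow_face_step_fixes_iff:
  assumes "snd t < l"
  shows "(face_step l ^^ n) t = t \<longleftrightarrow> l dvd n"
proof -
  have "(snd t + n) mod l = snd t \<longleftrightarrow> (snd t + n) mod l = snd t mod l" using assms by simp
  also have "\<dots> \<longleftrightarrow> l dvd n" by (subst mod_eq_dvd_iff_nat) simp_all
  finally show ?thesis using assms by (simp add: face_step_funpow prod_eq_iff)
qed

lemma card_orbit_eqI:
  assumes "(f ^^ k) t = t" and "k > 0" and "\<And>j. 0 < j \<Longrightarrow> j < k \<Longrightarrow> (f ^^ j) t \<noteq> t"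
  shows "card (orbit f t) = k"
proof -
  have self: "t \<in> orbit f t" using assms(1,2) by (rule self_in_orbitI)
  have "card (orbit f t) \<le> k"
    using funpow_fixes_iff[OF self] assms(1,2) by (metis dvd_imp_le)
  then show ?thesis
    using assms(3)[of "card (orbit f t)"] funpow_card_orbit[OF self] card_orbit_pos[OF self] by fastforce
qed

lemma bij_betw_of_finite_order:
  assumes "f ` S \<subseteq> S" and "\<And>s. s \<in> S \<Longrightarrow> (f ^^ n) s = s" and "n > 0"
  shows "bij_betw f S S"
proof -
  obtain m where m: "n = Suc m" using assms(3) by (cases n) auto
  have iter: "(f ^^ i) s \<in> S" if "s \<in> S" for i s
    using assms(1) that by (induction i) auto
  show ?thesis
    using assms(1,2) iter unfolding m
    by (intro bij_betw_byWitness[of _ "f ^^ m"]) (auto simp: funpow_swap1)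
qed

text \<open>
  Transitivity is witnessed by a spanning tree of the dual graph: the first dart of every face but
  face 0 is reversed into a face with a smaller number. Hence every nonempty invariant set contains
  \<open>(0, 0)\<close>; as complements of invariant sets are invariant, there is only one.
\<close>

lemma regular_map_of_faces:
  assumes pos: "0 < F" "0 < l" "0 < k"
    and z: "\<And>t. t \<in> darts F l \<Longrightarrow> z t \<in> darts F l \<and> z (z t) = t \<and> z t \<noteq> t"
    and x: "\<And>t. t \<in> darts F l \<Longrightarrow> ((face_step l \<circ> z) ^^ k) t = t"
      "\<And>t j. \<lbrakk>t \<in> darts F l; 0 < j; j < k\<rbrakk> \<Longrightarrow> ((face_step l \<circ> z) ^^ j) t \<noteq> t"
    and parent: "\<And>i. \<lbrakk>0 < i; i < F\<rbrakk> \<Longrightarrow> fst (z (i, 0)) < i"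
  shows "regular_map (darts F l) (face_step l \<circ> z) z k l"
proof -
  let ?T = "darts F l" and ?y = "face_step l"
  have y_in: "?y t \<in> ?T" if "t \<in> ?T" for t
    using that pos by (auto simp: darts_def face_step_def)
  have fin: "finite ?T" by (simp add: darts_def)
  have bij_y: "bij_betw ?y ?T ?T"
  proof (rule bij_betw_of_finite_order)
    show "?y ` ?T \<subseteq> ?T" using y_in by blast
    show "(?y ^^ l) t = t" if "t \<in> ?T" for t
      using that funpow_face_step_fixes_iff[of t l l] by (auto simp: darts_def)
  qed (use pos in simp)
  have bij_z: "bij_betw z ?T ?T"
    using z by (intro bij_betw_byWitness[of _ z]) auto
  have root: "(0, 0) \<in> B" if B: "B \<subseteq> ?T" "B \<noteq> {}" "?y ` B \<subseteq> B" "z ` B \<subseteq> B" for B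
  proof -
    have iter: "(?y ^^ n) t \<in> B" if "t \<in> B" for n t
      using that B(3) by (induction n) auto
    have "(i, j) \<in> B \<Longrightarrow> (0, 0) \<in> B" for i j
    proof (induction i arbitrary: j rule: less_induct)
      case (less i)
      then have ij: "i < F" "j < l" using B(1) by (auto simp: darts_def)
      then have i0: "(i, 0) \<in> B"
        using iter[OF less.prems, of "l - j"] by (simp add: face_step_funpow)
      show ?case
      proof (cases "i = 0")
        case False
        then have "fst (z (i, 0)) < i" using parent ij by simp
        moreover have "z (i, 0) \<in> B" using i0 B(4) by blast
        ultimately show ?thesis using less.IH[of "fst (z (i, 0))" "snd (z (i, 0))"] by simp
      qed (use i0 in simp)
    qed
    then show ?thesis using B(2) by fastforce
  qed
  show ?thesis
  proof
    show "finite ?T" by (rule fin)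
    show "?T \<noteq> {}" using pos by (auto simp: darts_def)
    show "bij_betw (?y \<circ> z) ?T ?T" using bij_z bij_y by (rule bij_betw_trans)
    fix t assume t: "t \<in> ?T"
    show "z t \<in> ?T" "z (z t) = t" "z t \<noteq> t" using z[OF t] by auto
    show "card (orbit (?y \<circ> z) t) = k" using x t pos by (intro card_orbit_eqI) auto
    have "orbit (?y \<circ> z \<circ> z) t = orbit ?y t"
      using t z y_in by (intro orbit_cong0[symmetric, of t ?T]) auto
    moreover have "card (orbit ?y t) = l"
      using t pos funpow_face_step_fixes_iff[of t l]
      by (intro card_orbit_eqI) (auto simp: darts_def dest: nat_dvd_not_less)
    ultimately show "card (orbit (?y \<circ> z \<circ> z) t) = l" by simp
  next
    fix A assume A: "A \<subseteq> ?T" "A \<noteq> {}" "(?y \<circ> z) ` A \<subseteq> A" "z ` A \<subseteq> A"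
    have yA: "?y ` A \<subseteq> A"
    proof
      fix s assume "s \<in> ?y ` A"
      then obtain t where t: "t \<in> A" "s = ?y t" by auto
      then have "z t \<in> A" "z (z t) = t" using A(1,4) z[of t] by auto
      then have "(?y \<circ> z) (z t) \<in> A" using A(3) by blast
      then show "s \<in> A" using t(2) \<open>z (z t) = t\<close> by simp
    qed
    show "A = ?T"
    proof (rule ccontr)
      assume "A \<noteq> ?T"
      then have ne: "?T - A \<noteq> {}" using A(1) by auto
      have finA: "finite A" using A(1) fin by (rule finite_subset)
      have outside: "f t \<in> ?T - A" if "bij_betw f ?T ?T" "f ` A \<subseteq> A" "t \<in> ?T - A" for f t
        using backward_closed[OF finA, of f ?T t] that A(1) by (auto simp: bij_betw_def)
      have "(0, 0) \<in> ?T - A"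
        using outside[OF bij_y yA] outside[OF bij_z A(4)] ne by (intro root) auto
      then show False using root[OF A(1,2) yA A(4)] by simp
    qed
  qed
qed

text \<open>
  Regularity for a tabulated reversal of darts, in a form that can be computed.
\<close>

definition reversal :: "(nat \<times> nat) list list \<Rightarrow> nat \<times> nat \<Rightarrow> nat \<times> nat" where
  "reversal tab t = tab ! fst t ! snd t"

definition regular_table :: "nat \<Rightarrow> nat \<Rightarrow> (nat \<times> nat) list list \<Rightarrow> bool" where
  "regular_table k l tab \<longleftrightarrow>
    (\<forall>t \<in> set (List.product [0..<length tab] [0..<l]).
      fst (reversal tab t) < length tab \<and> snd (reversal tab t) < l
      \<and> reversal tab (reversal tab t) = t \<and> reversal tab t \<noteq> t
      \<and> ((face_step l \<circ> reversal tab) ^^ k) t = t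
      \<and> (\<forall>j \<in> set [1..<k]. ((face_step l \<circ> reversal tab) ^^ j) t \<noteq> t))
    \<and> (\<forall>i \<in> set [1..<length tab]. fst (reversal tab (i, 0)) < i)"

lemma regular_map_of_table:
  assumes "regular_table k l tab" and "0 < length tab" and "0 < l" and "0 < k"
  shows "regular_map (darts (length tab) l) (face_step l \<circ> reversal tab) (reversal tab) k l"
proof (rule regular_map_of_faces[OF assms(2-4)])
  have *: "t \<in> darts (length tab) l \<longleftrightarrow> t \<in> set (List.product [0..<length tab] [0..<l])" for t
    by (auto simp: darts_def)
  fix t assume t: "t \<in> darts (length tab) l"
  note t' = t[unfolded *]
  show "reversal tab t \<in> darts (length tab) l \<and> reversal tab (reversal tab t) = t \<and> reversal tab t \<noteq> t"
    using assms(1) t' by (simp add: regular_table_def darts_def mem_Times_iff del: set_product)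
  show "((face_step l \<circ> reversal tab) ^^ k) t = t"
    using assms(1) t' unfolding regular_table_def by blast
  fix j assume "0 < j" "j < k"
  then have "j \<in> set [1..<k]" by simp
  then show "((face_step l \<circ> reversal tab) ^^ j) t \<noteq> t"
    using assms(1) t' unfolding regular_table_def by blast
next
  fix i assume "0 < i" "i < length tab"
  then have "i \<in> set [1..<length tab]" by simp
  then show "fst (reversal tab (i, 0)) < i" using assms(1) unfolding regular_table_def by blast
qed

text \<open>
  The faces of each table are numbered in breadth-first order, and every face but face 0 starts with
  its edge to the face from which it was first reached.
\<close>

definition tetrahedron :: "(nat \<times> nat) list list" where
  "tetrahedron = [[(1, 0), (2, 0), (3, 0)], [(0, 0), (3, 2), (2, 1)],
    [(0, 1), (1, 2), (3, 1)], [(0, 2), (2, 2), (1, 1)]]"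

definition cube :: "(nat \<times> nat) list list" where
  "cube = [[(1, 0), (2, 0), (3, 0), (4, 0)], [(0, 0), (4, 3), (5, 0), (2, 1)],
    [(0, 1), (1, 3), (5, 3), (3, 1)], [(0, 2), (2, 3), (5, 2), (4, 1)],
    [(0, 3), (3, 3), (5, 1), (1, 1)], [(1, 2), (4, 2), (3, 2), (2, 2)]]"

definition dodecahedron :: "(nat \<times> nat) list list" where
  "dodecahedron = [[(1, 0), (2, 0), (3, 0), (4, 0), (5, 0)], [(0, 0), (5, 4), (6, 0), (7, 0), (2, 1)],
    [(0, 1), (1, 4), (7, 4), (8, 0), (3, 1)], [(0, 2), (2, 4), (8, 4), (9, 0), (4, 1)],
    [(0, 3), (3, 4), (9, 4), (10, 0), (5, 1)], [(0, 4), (4, 4), (10, 4), (6, 1), (1, 1)],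
    [(1, 2), (5, 3), (10, 3), (11, 0), (7, 1)], [(1, 3), (6, 4), (11, 4), (8, 1), (2, 2)],
    [(2, 3), (7, 3), (11, 3), (9, 1), (3, 2)], [(3, 3), (8, 3), (11, 2), (10, 1), (4, 2)],
    [(4, 3), (9, 3), (11, 1), (6, 2), (5, 2)], [(6, 3), (10, 2), (9, 2), (8, 2), (7, 2)]]"

lemma regular_tables:
  "regular_table 3 3 tetrahedron" "regular_table 3 4 cube" "regular_table 3 5 dodecahedron"
  by code_simp+

text \<open>
  Two \<open>r\<close>-gons glued along their boundaries, which they traverse in opposite directions:
  the reversal is \<open>(i, j) \<mapsto> (1 - i, - j mod r)\<close>.
\<close>

definition dihedron :: "nat \<Rightarrow> nat \<times> nat \<Rightarrow> nat \<times> nat" where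
  "dihedron r t = (1 - fst t, if snd t = 0 then 0 else r - snd t)"

lemma rotation_dihedron:
  assumes "2 \<le> r" and "j < r"
  shows "face_step r (dihedron r (i, j)) = (1 - i, if j = 0 then 1 else if j = 1 then 0 else Suc r - j)"
  using assms by (auto simp: face_step_def dihedron_def Suc_diff_le)

lemma regular_map_dihedron:
  assumes "2 \<le> r"
  shows "regular_map (darts 2 r) (face_step r \<circ> dihedron r) (dihedron r) 2 r"
proof (rule regular_map_of_faces)
  let ?x = "face_step r \<circ> dihedron r"
  have once: "(?x ^^ 1) t \<noteq> t" and twice: "(?x ^^ 2) t = t" if dart: "t \<in> darts 2 r" for t
  proof -
    obtain i j where t: "t = (i, j)" "i < 2" "j < r" using dart by (auto simp: darts_def)
    then have "i = 0 \<or> i = 1" by auto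
    then show "(?x ^^ 1) t \<noteq> t"
      using rotation_dihedron[OF assms t(3), of i] unfolding t by auto
    show "(?x ^^ 2) t = t"
      using assms t \<open>i = 0 \<or> i = 1\<close> rotation_dihedron[OF assms] by (auto simp: numeral_2_eq_2)
  qed
  show "(?x ^^ 2) t = t" if "t \<in> darts 2 r" for t using twice that .
  show "(?x ^^ j) t \<noteq> t" if "t \<in> darts 2 r" "0 < j" "j < 2" for t j
  proof -
    have "j = 1" using that by simp
    then show ?thesis using once[OF that(1)] by blast
  qed
qed (use assms in \<open>auto simp: darts_def dihedron_def, presburger+\<close>)

section \<open>Adjacent faces of a Platonic map\<close>

text \<open>
  The faces are the orbits of \<open>y\<close>; the two faces along the edge of \<open>t\<close> have no other edge in common.
\<close>

definition single_common_edge :: "('t \<Rightarrow> 't) \<Rightarrow> ('t \<Rightarrow> 't) \<Rightarrow> 't \<Rightarrow> bool" where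
  "single_common_edge y z t \<longleftrightarrow> (\<forall>w \<in> orbit y (z t). w \<noteq> z t \<longrightarrow> z w \<notin> orbit y t)"

lemma orbit_conv_list:
  assumes "(f ^^ n) t = t" and "0 < n"
  shows "orbit f t = set (map (\<lambda>m. (f ^^ m) t) [0..<n])"
  using orbit_altdef_bounded[OF assms] by auto

lemma single_common_edge_code:
  assumes "(f ^^ n) t = t" and "(f ^^ n) (z t) = z t" and "0 < n"
    and "\<forall>w \<in> set (map (\<lambda>m. (f ^^ m) (z t)) [0..<n]).
      w \<noteq> z t \<longrightarrow> z w \<notin> set (map (\<lambda>m. (f ^^ m) t) [0..<n])"
  shows "single_common_edge f z t"
  unfolding single_common_edge_def orbit_conv_list[OF assms(1,3)] orbit_conv_list[OF assms(2,3)]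
  by (rule assms(4))

lemma single_common_edge_tables:
  "single_common_edge (face_step 3) (reversal tetrahedron) (0, 0)"
  "single_common_edge (face_step 4) (reversal cube) (0, 0)"
  "single_common_edge (face_step 4 \<circ> reversal cube) (reversal cube) (0, 0)"
  "single_common_edge (face_step 5) (reversal dodecahedron) (0, 0)"
  "single_common_edge (face_step 5 \<circ> reversal dodecahedron) (reversal dodecahedron) (0, 0)"
proof -
  show "single_common_edge (face_step 3) (reversal tetrahedron) (0, 0)"
    by (rule single_common_edge_code[where n = 3]; code_simp)
  show "single_common_edge (face_step 4) (reversal cube) (0, 0)"
    by (rule single_common_edge_code[where n = 4]; code_simp)
  show "single_common_edge (face_step 4 \<circ> reversal cube) (reversal cube) (0, 0)"
    by (rule single_common_edge_code[where n = 3]; code_simp)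
  show "single_common_edge (face_step 5) (reversal dodecahedron) (0, 0)"
    by (rule single_common_edge_code[where n = 5]; code_simp)
  show "single_common_edge (face_step 5 \<circ> reversal dodecahedron) (reversal dodecahedron) (0, 0)"
    by (rule single_common_edge_code[where n = 3]; code_simp)
qed

text \<open>
  The faces of the dual of a dihedron are digons. The two edges of a digon lie on different
  neighbours when \<open>r \<ge> 3\<close>, whereas for \<open>r = 2\<close> there are only two digons, with both edges in common.
\<close>

lemma single_common_edge_hosohedron:
  assumes "3 \<le> r"
  shows "single_common_edge (face_step r \<circ> dihedron r) (dihedron r) (0, 0)"
proof (rule single_common_edge_code[where n = 2])
  show "((face_step r \<circ> dihedron r) ^^ 2) (0, 0) = (0, 0)"
    "((face_step r \<circ> dihedron r) ^^ 2) (dihedron r (0, 0)) = dihedron r (0, 0)"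
    using assms by (auto simp: numeral_2_eq_2 face_step_def dihedron_def)
  show "\<forall>w \<in> set (map (\<lambda>m. ((face_step r \<circ> dihedron r) ^^ m) (dihedron r (0, 0))) [0..<2]).
      w \<noteq> dihedron r (0, 0) \<longrightarrow>
      dihedron r w \<notin> set (map (\<lambda>m. ((face_step r \<circ> dihedron r) ^^ m) (0, 0)) [0..<2])"
    using assms by (auto simp: numeral_2_eq_2 face_step_def dihedron_def)
qed simp

lemma tetrahedron_vertex_meets_face_once:
  "orbit (face_step 3 \<circ> reversal tetrahedron) (0, 0) \<inter> orbit (face_step 3) (0, 0) = {(0, 0)}"
proof -
  have period: "((face_step 3 \<circ> reversal tetrahedron) ^^ 3) (0, 0) = (0, 0)" "(face_step 3 ^^ 3) (0, 0) = (0, 0)"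
    by code_simp+
  have "set (map (\<lambda>m. ((face_step 3 \<circ> reversal tetrahedron) ^^ m) (0, 0)) [0..<3])
      \<inter> set (map (\<lambda>m. (face_step 3 ^^ m) (0, 0)) [0..<3]) = {(0, 0)}"
    by code_simp
  then show ?thesis
    using orbit_conv_list[OF period(1)] orbit_conv_list[OF period(2)] by simp
qed

lemma (in connected_map) single_common_edge_flip_flip:
  assumes "f ` S \<subseteq> S" and "s \<in> S" and "single_common_edge f \<alpha> s"
  shows "single_common_edge (f \<circ> \<alpha> \<circ> \<alpha>) \<alpha> s"
  using assms \<alpha>_in[OF assms(2)]
  unfolding single_common_edge_def by (simp only: orbit_flip_flip)

text \<open>
  The second clause says that \<open>card T\<close> is twice the number \<open>2 k l / (2 k + 2 l - k l)\<close> of edges. The last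
  two are the incidence facts that exclude adjacent exceptional faces, and an exceptional
  vertex on an exceptional face.
\<close>

definition platonic :: "'t set \<Rightarrow> ('t \<Rightarrow> 't) \<Rightarrow> ('t \<Rightarrow> 't) \<Rightarrow> nat \<Rightarrow> nat \<Rightarrow> bool" where
  "platonic T x z k l \<longleftrightarrow> regular_map T x z k l
    \<and> card T * (2 * (k + l) - k * l) = 4 * k * l
    \<and> (k \<noteq> 2 \<longrightarrow> (\<exists>t\<in>T. single_common_edge (x \<circ> z) z t))
    \<and> (k = 3 \<and> l = 3 \<longrightarrow> (\<exists>t\<in>T. orbit x t \<inter> orbit (x \<circ> z) t = {t}))"

lemma platonic_of_faces:
  assumes "regular_map (darts F l) (face_step l \<circ> z) z k l"
    and "F * l * (2 * (k + l) - k * l) = 4 * k * l"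
    and "k \<noteq> 2 \<Longrightarrow> single_common_edge (face_step l) z (0, 0)"
    and "k = 3 \<Longrightarrow> l = 3
      \<Longrightarrow> orbit (face_step l \<circ> z) (0, 0) \<inter> orbit (face_step l) (0, 0) = {(0, 0)}"
  shows "platonic (darts F l) (face_step l \<circ> z) z k l"
proof -
  interpret regular_map "darts F l" "face_step l \<circ> z" z k l by (rule assms(1))
  have base: "(0, 0) \<in> darts F l" using nonempty by (auto simp: darts_def)
  have closed: "face_step l ` darts F l \<subseteq> darts F l"
    using degrees_pos by (auto simp: darts_def face_step_def)
  have "card (darts F l) = F * l" by (simp add: darts_def)
  then show ?thesis
    unfolding platonic_def
    using assms base single_common_edge_flip_flip[OF closed base] orbit_flip_flip[OF closed base]
    by metis
qed

lemma platonic_of_dual_faces: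
  assumes "regular_map (darts F k) (face_step k \<circ> z) z l k"
    and "F * k * (2 * (k + l) - k * l) = 4 * k * l"
    and "single_common_edge (face_step k \<circ> z) z (0, 0)"
    and "k \<noteq> 3 \<or> l \<noteq> 3"
  shows "platonic (darts F k) (face_step k \<circ> z \<circ> z) z k l"
proof -
  interpret regular_map "darts F k" "face_step k \<circ> z" z l k by (rule assms(1))
  have base: "(0, 0) \<in> darts F k" using nonempty by (auto simp: darts_def)
  have closed: "(face_step k \<circ> z) ` darts F k \<subseteq> darts F k"
    using bij_\<sigma> by (simp add: bij_betw_def)
  have "card (darts F k) = F * k" by (simp add: darts_def)
  then show ?thesis
    unfolding platonic_def
    using assms dual base single_common_edge_flip_flip[OF closed base assms(3)] by metis
qed

text \<open>
  For \<open>k = a + 3\<close> and \<open>l = b + 3\<close> the inequality becomes \<open>a b + a + b < 3\<close>.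
\<close>

lemma spherical_types:
  fixes k l :: nat
  assumes "2 \<le> k" and "2 \<le> l" and "k * l < 2 * (k + l)"
  obtains "k = 2" | "k \<ge> 3" "l = 2" | "k = 3" "l = 3" | "k = 3" "l = 4" | "k = 3" "l = 5"
    | "k = 4" "l = 3" | "k = 5" "l = 3"
proof (cases "k = 2 \<or> l = 2")
  case True
  then show ?thesis using that(1,2) assms(1) by (cases "k = 2") auto
next
  case False
  then obtain a b where ab: "k = a + 3" "l = b + 3"
    using assms(1,2) by (metis add.commute le_Suc_ex le_neq_implies_less numeral_3_eq_3
        numeral_2_eq_2 Suc_leI)
  have "a * b + a + b < 3" using assms(3) unfolding ab by (simp add: algebra_simps)
  moreover have "a = 0 \<or> b = 0 \<or> 1 \<le> a * b" by (cases a; cases b) auto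
  ultimately have "a = 0 \<and> b = 0 \<or> a = 0 \<and> b = 1 \<or> a = 0 \<and> b = 2 \<or> a = 1 \<and> b = 0 \<or> a = 2 \<and> b = 0"
    by linarith
  then show ?thesis using that(3-7) ab by auto
qed

lemma platonic_map_exists:
  assumes "2 \<le> k" and "2 \<le> l" and "k * l < 2 * (k + l)"
  shows "\<exists>(T :: (nat \<times> nat) set) x z. platonic T x z k l"
  using assms
proof (cases rule: spherical_types)
  case 1
  have "platonic (darts 2 l) (face_step l \<circ> dihedron l) (dihedron l) k l"
    using regular_map_dihedron[OF assms(2)] 1 by (intro platonic_of_faces) auto
  then show ?thesis by blast
next
  case 2
  have "platonic (darts 2 k) (face_step k \<circ> dihedron k \<circ> dihedron k) (dihedron k) k l"
    using regular_map_dihedron[OF assms(1)] single_common_edge_hosohedron 2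
    by (intro platonic_of_dual_faces) auto
  then show ?thesis by blast
next
  case 3
  have "length tetrahedron = 4" by (simp add: tetrahedron_def)
  then have "platonic (darts 4 3) (face_step 3 \<circ> reversal tetrahedron) (reversal tetrahedron) 3 3"
    using regular_map_of_table[OF regular_tables(1)] single_common_edge_tables(1)
      tetrahedron_vertex_meets_face_once
    by (intro platonic_of_faces) auto
  then show ?thesis using 3 by blast
next
  case 4
  have "length cube = 6" by (simp add: cube_def)
  then have "platonic (darts 6 4) (face_step 4 \<circ> reversal cube) (reversal cube) 3 4"
    using regular_map_of_table[OF regular_tables(2)] single_common_edge_tables(2)
    by (intro platonic_of_faces) auto
  then show ?thesis using 4 by blast
next
  case 5
  have "length dodecahedron = 12" by (simp add: dodecahedron_def)
  then have "platonic (darts 12 5) (face_step 5 \<circ> reversal dodecahedron) (reversal dodecahedron) 3 5"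
    using regular_map_of_table[OF regular_tables(3)] single_common_edge_tables(4)
    by (intro platonic_of_faces) auto
  then show ?thesis using 5 by blast
next
  case 6
  have "length cube = 6" by (simp add: cube_def)
  then have "platonic (darts 6 4) (face_step 4 \<circ> reversal cube \<circ> reversal cube) (reversal cube) 4 3"
    using regular_map_of_table[OF regular_tables(2)] single_common_edge_tables(3)
    by (intro platonic_of_dual_faces) auto
  then show ?thesis using 6 by blast
next
  case 7
  have "length dodecahedron = 12" by (simp add: dodecahedron_def)
  then have "platonic (darts 12 5) (face_step 5 \<circ> reversal dodecahedron \<circ> reversal dodecahedron)
      (reversal dodecahedron) 5 3"
    using regular_map_of_table[OF regular_tables(3)] single_common_edge_tables(5)
    by (intro platonic_of_dual_faces) auto
  then show ?thesis using 7 by blast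
qed

section \<open>Plane graphs as spherical maps\<close>

context plane_graph
begin

lemma rot_in: "a \<in> arcs G \<Longrightarrow> rot a \<in> arcs G"
  using rot_permutes by (simp add: permutes_in_image)

lemma orbit_rot:
  assumes "a \<in> arcs G"
  shows "orbit rot a = out_arcs G (tail G a)"
proof -
  have "cyclic_on rot (out_arcs G (tail G a))"
    using assms by (intro rot_cyclic) auto
  then show ?thesis using assms by (intro orbit_cyclic_eq3) auto
qed

lemma reachable_closed:
  assumes "reachable (mk_symmetric G) u v" and "u \<in> B"
    and B: "\<And>a. a \<in> arcs G \<Longrightarrow> tail G a \<in> B \<Longrightarrow> head G a \<in> B"
  shows "v \<in> B"
  using assms(1)[unfolded reachable_def]
proof (induction rule: rtrancl_on_induct)
  case base
  show ?case by (rule assms(2))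
next
  case (step x y)
  then obtain a where a: "a \<in> arcs G" "(x, y) = (tail G a, head G a) \<or> (x, y) = (head G a, tail G a)"
    by (auto simp: parcs_mk_symmetric)
  then show ?case
    using B[of a] B[of "arev a"] step.IH by auto
qed

text \<open>
  A rotation orbit contains all arcs at its vertex, so the tails of an invariant set of arcs are
  closed under adjacency.
\<close>

lemma verts_subset:
  assumes "A \<subseteq> arcs G" and "A \<noteq> {}" and "rot ` A \<subseteq> A" and "arev ` A \<subseteq> A"
  shows "verts G \<subseteq> tail G ` A"
proof
  fix v assume v: "v \<in> verts G"
  obtain a where a: "a \<in> A" using assms(2) by auto
  have "reachable (mk_symmetric G) (tail G a) v"
    using connected a v assms(1) unfolding Digraph_Component.connected_def strongly_connected_def by auto
  then show "v \<in> tail G ` A"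
  proof (rule reachable_closed)
    show "tail G a \<in> tail G ` A" using a by simp
    fix b assume b: "b \<in> arcs G" "tail G b \<in> tail G ` A"
    then obtain c where c: "c \<in> A" "tail G c = tail G b" by auto
    then have "b \<in> orbit rot c" using orbit_rot[of c] assms(1) b by auto
    then have "b \<in> A" using orbit_subset_of_closed[OF c(1) assms(3)] by auto
    then have "tail G (arev b) \<in> tail G ` A" using assms(4) by auto
    then show "head G b \<in> tail G ` A" using b by simp
  qed
qed

lemma arcs_nonempty: "arcs G \<noteq> {}"
  using has_edge by (auto simp: map_edges_def)

lemma verts_eq: "verts G = tail G ` arcs G"
proof
  show "verts G \<subseteq> tail G ` arcs G"
    using arcs_nonempty rot_in by (intro verts_subset) auto
qed auto

lemma orbits_rot: "orbit rot ` arcs G = out_arcs G ` verts G"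
  unfolding verts_eq by (auto simp: orbit_rot image_image)

lemma inj_on_out_arcs: "inj_on (out_arcs G) (verts G)"
proof
  fix x y assume "x \<in> verts G" "y \<in> verts G" "out_arcs G x = out_arcs G y"
  then show "x = y" unfolding verts_eq by (auto simp: out_arcs_def)
qed

lemma card_arcs: "card (arcs G) = 2 * card (map_edges G arev)"
proof -
  have "2 * card (map_edges G arev) = card (\<Union> (map_edges G arev))"
  proof (rule card_partition)
    have eq: "map_edges G arev = (\<lambda>a. {a, arev a}) ` arcs G" by (auto simp: map_edges_def)
    show "finite (map_edges G arev)" unfolding eq by simp
    then show "finite (\<Union> (map_edges G arev))" by (auto simp: map_edges_def)
    show "card e = 2" if "e \<in> map_edges G arev" for e
      using that arev_neq by (fastforce simp: map_edges_def)
    show "e \<inter> e' = {}" if "e \<in> map_edges G arev" "e' \<in> map_edges G arev" "e \<noteq> e'" for e e'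
      using that by (auto simp: map_edges_def arev_eq_iff)
  qed
  moreover have "\<Union> (map_edges G arev) = arcs G" by (auto simp: map_edges_def)
  ultimately show ?thesis by simp
qed

lemma spherical_map: "spherical_map (arcs G) rot arev"
proof unfold_locales
  show "finite (arcs G)" "arcs G \<noteq> {}" "bij_betw rot (arcs G) (arcs G)"
    using arcs_nonempty rot_permutes by (auto intro: permutes_imp_bij)
  show "arev a \<in> arcs G" "arev (arev a) = a" "arev a \<noteq> a" if "a \<in> arcs G" for a
    using that arev_neq by auto
  have V: "card (verts G) = card (orbit rot ` arcs G)"
    unfolding orbits_rot using inj_on_out_arcs by (simp add: card_image)
  show "2 * (card (orbit rot ` arcs G) + card (orbit (rot \<circ> arev) ` arcs G)) = card (arcs G) + 4"
  proof -
    have "int (2 * (card (orbit rot ` arcs G) + card (orbit (rot \<circ> arev) ` arcs G)))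
        = int (card (arcs G) + 4)"
      using sphere unfolding V card_arcs map_faces_def by simp
    then show ?thesis by (simp only: of_nat_eq_iff)
  qed
  fix A assume A: "A \<subseteq> arcs G" "A \<noteq> {}" "rot ` A \<subseteq> A" "arev ` A \<subseteq> A"
  have "a \<in> A" if a: "a \<in> arcs G" for a
  proof -
    have "tail G a \<in> verts G" using a by simp
    then obtain b where b: "b \<in> A" "tail G b = tail G a" using verts_subset[OF A] by force
    then have "a \<in> orbit rot b" using orbit_rot[of b] A(1) a by auto
    then show ?thesis using orbit_subset_of_closed[OF b(1) A(3)] by auto
  qed
  then show "A = arcs G" using A(1) by auto
qed

lemma exceptional_vertex_orbits:
  "{c \<in> orbit rot ` arcs G. \<not> k dvd card c} = out_arcs G ` exceptional_vertices k G"
  unfolding orbits_rot by (auto simp: exceptional_vertices_def vertex_degree_def out_degree_def)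

lemma card_exceptional_vertices:
  "card {c \<in> orbit rot ` arcs G. \<not> k dvd card c} = card (exceptional_vertices k G)"
  unfolding exceptional_vertex_orbits
  by (intro card_image inj_on_subset[OF inj_on_out_arcs]) (auto simp: exceptional_vertices_def)

lemma exceptional_face_orbits:
  "{c \<in> orbit (rot \<circ> arev) ` arcs G. \<not> l dvd card c} = exceptional_faces l G arev rot"
  by (simp add: exceptional_faces_def map_faces_def face_degree_def)

text \<open>
  The handshake lemma, and its dual for faces. They exclude a single exceptional vertex for \<open>k = 2\<close> and
  a single exceptional face for \<open>l = 2\<close>, types that the gcd condition leaves open.
\<close>

lemma even_card_odd_vertices: "even (card (exceptional_vertices 2 G))"
proof -
  have "(\<Sum>c\<in>orbit rot ` arcs G. card c) = card (arcs G)"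
    using rot_permutes by (intro sum_card_orbits permutes_imp_bij) auto
  then have "even (\<Sum>c\<in>orbit rot ` arcs G. card c)" by (simp add: card_arcs)
  then show ?thesis
    using card_exceptional_vertices[of 2] by (simp add: even_sum_iff)
qed

lemma even_card_odd_faces: "even (card (exceptional_faces 2 G arev rot))"
proof -
  interpret spherical_map "arcs G" rot arev by (rule spherical_map)
  have "(\<Sum>c\<in>orbit (rot \<circ> arev) ` arcs G. card c) = card (arcs G)"
    by (rule sum_card_orbits[OF finite bij_\<phi>])
  then have "even (\<Sum>c\<in>orbit (rot \<circ> arev) ` arcs G. card c)" by (simp add: card_arcs)
  then show ?thesis
    unfolding exceptional_face_orbits[symmetric] by (simp add: even_sum_iff)
qed

text \<open>
  Counting excludes all Euclidean and hyperbolic types, so that a Platonic covering is available.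
\<close>

lemma exists_platonic_covering:
  assumes "2 \<le> k" and "2 \<le> l"
    and "card (exceptional_vertices k G) + card (exceptional_faces l G arev rot) \<le> 2"
  shows "k * l < 2 * (k + l)"
    and "\<exists>(T :: (nat \<times> nat) set) x z. platonic T x z k l \<and> platonic_covering (arcs G) rot arev T x z k l"
proof -
  interpret spherical_map "arcs G" rot arev by (rule spherical_map)
  show "k * l < 2 * (k + l)"
    using assms by (intro spherical_type) (simp_all only: card_exceptional_vertices exceptional_face_orbits)
  then obtain T :: "(nat \<times> nat) set" and x z where T: "platonic T x z k l"
    using platonic_map_exists assms(1,2) by blast
  then have "platonic_covering (arcs G) rot arev T x z k l"
    using spherical_map by (simp add: platonic_covering_def platonic_def)
  then show "\<exists>(T :: (nat \<times> nat) set) x z. platonic T x z k l \<and> platonic_covering (arcs G) rot arev T x z k l"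
    using T by blast
qed

lemma finite_exceptional:
  "finite (exceptional_vertices k G)" "finite (exceptional_faces l G arev rot)"
  by (simp_all add: exceptional_vertices_def exceptional_faces_def map_faces_def)

section \<open>Plane graphs with one or two exceptions\<close>

lemma no_1_uniform:
  assumes "2 \<le> k" and "2 \<le> l"
  shows "\<not> uniform_of_type 1 k l G arev rot"
proof
  assume one: "uniform_of_type 1 k l G arev rot"
  then obtain T :: "(nat \<times> nat) set" and x z where "platonic_covering (arcs G) rot arev T x z k l"
    using exists_platonic_covering(2)[OF assms] by (auto simp: uniform_of_type_def)
  then interpret platonic_covering "arcs G" rot arev T x z k l .
  show False
    using not_one_exception one
    unfolding uniform_of_type_def card_exceptional_vertices exceptional_face_orbits by simp
qed

lemma two_exceptional_faces_only:
  assumes "uniform_of_type 2 k l G arev rot"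
    and "f \<in> exceptional_faces l G arev rot" and "g \<in> exceptional_faces l G arev rot" and "f \<noteq> g"
  shows "exceptional_vertices k G = {}" and "exceptional_faces l G arev rot = {f, g}"
proof -
  have sub: "{f, g} \<subseteq> exceptional_faces l G arev rot" using assms by auto
  have "card {f, g} = 2" using assms(4) by simp
  moreover have "card {f, g} \<le> card (exceptional_faces l G arev rot)"
    using sub by (rule card_mono[OF finite_exceptional(2)])
  ultimately have card: "card (exceptional_vertices k G) = 0"
    "card {f, g} = card (exceptional_faces l G arev rot)"
    using assms(1) by (auto simp: uniform_of_type_def)
  show "exceptional_vertices k G = {}" using card(1) finite_exceptional(1) by simp
  show "exceptional_faces l G arev rot = {f, g}"
    using card_subset_eq[OF finite_exceptional(2) sub card(2)] by simp
qed

lemma two_uniform_faces: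
  assumes "2 \<le> k" and "2 \<le> l" and "uniform_of_type 2 k l G arev rot"
    and "f \<in> exceptional_faces l G arev rot" and "g \<in> exceptional_faces l G arev rot" and "f \<noteq> g"
  shows "gcd (card f) l = gcd (card g) l"
    and "of_nat (card (map_edges G arev)) / platonic_edges k l
        * (of_nat l / of_nat (gcd (card f) l)) \<in> \<int>"
    and "k \<noteq> 2 \<Longrightarrow> \<not> faces_adjacent G arev f g"
proof -
  obtain T :: "(nat \<times> nat) set" and x z where
    T: "platonic T x z k l" and "platonic_covering (arcs G) rot arev T x z k l"
    using exists_platonic_covering(2)[OF assms(1,2)] assms(3) by (auto simp: uniform_of_type_def)
  then interpret platonic_covering "arcs G" rot arev T x z k l by simp
  have kl: "k * l < 2 * (k + l)"
    using exists_platonic_covering(1)[OF assms(1,2)] assms(3) by (auto simp: uniform_of_type_def)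
  have odd: "ramified_vertices = {}" "ramified_faces = {f, g}"
    using two_exceptional_faces_only[OF assms(3-6)]
    unfolding exceptional_vertex_orbits exceptional_face_orbits by simp_all
  obtain N where N: "N * gcd (card f) l = l" "N * gcd (card g) l = l" "card T dvd N * card (arcs G)"
    using two_exceptional_faces(1)[OF odd assms(6)] by blast
  have "N > 0" using N(1) assms(2) by (cases N) auto
  then show "gcd (card f) l = gcd (card g) l" using N by (metis mult_cancel1 not_gr_zero)
  show "of_nat (card (map_edges G arev)) / platonic_edges k l
      * (of_nat l / of_nat (gcd (card f) l)) \<in> \<int>"
  proof -
    have "of_nat (card T) * (of_nat (2 * (k + l) - k * l)) = (of_nat (4 * k * l) :: rat)"
      using T unfolding platonic_def by (simp only: of_nat_mult[symmetric])
    moreover have "2 * (k + l) - k * l > 0" using kl by simp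
    moreover define e :: rat where "e = 2 * of_nat k + 2 * of_nat l - of_nat k * of_nat l"
    moreover have "of_nat (2 * (k + l) - k * l) = e"
      using kl by (simp add: e_def of_nat_diff)
    ultimately have "2 * of_nat k * of_nat l = of_nat (card T) / 2 * e" and "e \<noteq> 0"
      by auto
    then have edges: "platonic_edges k l = of_nat (card T) / 2"
      unfolding platonic_edges_def e_def by simp
    have index: "of_nat l / of_nat (gcd (card f) l) = (of_nat N :: rat)"
    proof -
      have "of_nat N * of_nat (gcd (card f) l) = (of_nat l :: rat)"
        using N(1) by (simp only: of_nat_mult[symmetric])
      moreover have "gcd (card f) l > 0" using assms(2) by simp
      ultimately show ?thesis by (simp add: field_simps)
    qed
    have "of_nat (card (map_edges G arev)) / platonic_edges k l
      * (of_nat l / of_nat (gcd (card f) l)) = of_nat (N * card (arcs G)) / (of_nat (card T) :: rat)"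
      unfolding edges index by (simp add: card_arcs)
    also have "\<dots> \<in> \<int>"
    proof -
      obtain q where "N * card (arcs G) = card T * q" using N(3) by (rule dvdE)
      moreover have "card T > 0" using T.finite T.nonempty by (simp add: card_gt_0_iff)
      ultimately show ?thesis by simp
    qed
    finally show ?thesis .
  qed
  assume "k \<noteq> 2"
  then obtain t where t: "t \<in> T" "single_common_edge (x \<circ> z) z t"
    using T unfolding platonic_def by blast
  show "\<not> faces_adjacent G arev f g"
  proof
    assume "faces_adjacent G arev f g"
    then obtain a where a: "a \<in> arcs G" "{a, arev a} \<inter> f \<noteq> {}" "{a, arev a} \<inter> g \<noteq> {}"
      by (auto simp: faces_adjacent_def map_edges_def)
    have disj: "f \<inter> g = {}"
    proof -
      have "f \<in> orbit (rot \<circ> arev) ` arcs G" "g \<in> orbit (rot \<circ> arev) ` arcs G"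
        using odd(2) by blast+
      then show ?thesis
        using orbit_of_member(2)[OF D.finite D.bij_\<phi>] assms(6) by blast
    qed
    have "a \<in> f \<or> arev a \<in> f" "a \<in> g \<or> arev a \<in> g" using a by auto
    then have "(a \<in> f \<and> arev a \<in> g) \<or> (arev a \<in> f \<and> arev (arev a) \<in> g)"
      using disj by auto
    then obtain d where "d \<in> f" "arev d \<in> g" by blast
    then show False
      using two_exceptional_faces(2)[OF odd assms(6) _ _ t(1)] t(2) unfolding single_common_edge_def
      by blast
  qed
qed

lemma two_uniform_vertex_and_face:
  assumes "2 \<le> k" and "2 \<le> l" and "uniform_of_type 2 k l G arev rot"
    and "v \<in> exceptional_vertices k G" and "f \<in> exceptional_faces l G arev rot"
  shows "k = 3 \<and> l = 3" and "even (card (map_edges G arev))" and "\<not> incident G v f"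
proof -
  have card: "card (exceptional_vertices k G) = 1" "card (exceptional_faces l G arev rot) = 1"
  proof -
    have "card (exceptional_vertices k G) > 0" "card (exceptional_faces l G arev rot) > 0"
      using assms(4,5) finite_exceptional by (auto simp: card_gt_0_iff)
    then show "card (exceptional_vertices k G) = 1" "card (exceptional_faces l G arev rot) = 1"
      using assms(3) by (auto simp: uniform_of_type_def)
  qed
  then have single: "exceptional_vertices k G = {v}" "exceptional_faces l G arev rot = {f}"
    using assms(4,5) by (auto simp: card_1_singleton_iff)
  obtain T :: "(nat \<times> nat) set" and x z where
    T: "platonic T x z k l" and "platonic_covering (arcs G) rot arev T x z k l"
    using exists_platonic_covering(2)[OF assms(1,2)] assms(3) by (auto simp: uniform_of_type_def)
  then interpret platonic_covering "arcs G" rot arev T x z k l by simp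
  have kl: "k * l < 2 * (k + l)"
    using exists_platonic_covering(1)[OF assms(1,2)] assms(3) by (auto simp: uniform_of_type_def)
  have odd: "ramified_vertices = {out_arcs G v}" "ramified_faces = {f}"
    using single unfolding exceptional_vertex_orbits exceptional_face_orbits by simp_all
  obtain N where N: "N * gcd (card (out_arcs G v)) k = k" "N * gcd (card f) l = l"
    "card T dvd N * card (arcs G)"
    using exceptional_vertex_and_face(1)[OF odd] by blast
  have "N \<noteq> 1"
  proof
    assume "N = 1"
    then have "k dvd card (out_arcs G v)" using N(1) by (metis gcd_dvd1 mult_1)
    then show False using odd(1) by blast
  qed
  have dvd: "N dvd k" "N dvd l" using N(1,2) by (metis dvd_triv_left)+
  have "k \<noteq> 2" using even_card_odd_vertices card(1) by auto
  moreover have "l \<noteq> 2" using even_card_odd_faces card(2) by auto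
  moreover have "gcd k l \<noteq> 1" using dvd \<open>N \<noteq> 1\<close> by (metis gcd_greatest nat_dvd_1_iff_1)
  moreover have "gcd 3 4 = (1 :: nat)" "gcd 3 5 = (1 :: nat)" "gcd 4 3 = (1 :: nat)" "gcd 5 3 = (1 :: nat)"
    by (simp_all add: gcd_non_0_nat)
  ultimately show type: "k = 3 \<and> l = 3"
    by (cases rule: spherical_types[OF assms(1,2) kl]) simp_all
  show "even (card (map_edges G arev))"
  proof -
    have "card T = 12" using T type unfolding platonic_def by simp
    moreover have "N * card (arcs G) dvd 3 * card (arcs G)" using dvd type by (simp add: mult_dvd_mono)
    ultimately have "12 dvd 3 * card (arcs G)" using N(3) dvd_trans by metis
    then obtain q where "3 * card (arcs G) = 12 * q" by (rule dvdE)
    then have "card (map_edges G arev) = 2 * q" by (simp add: card_arcs)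
    then show ?thesis by simp
  qed
  show "\<not> incident G v f"
  proof
    assume "incident G v f"
    then obtain d where d: "d \<in> f" "tail G d = v" by (auto simp: incident_def)
    have "f \<in> orbit (rot \<circ> arev) ` arcs G" using odd(2) by blast
    then have "d \<in> arcs G" by (rule orbit_of_member(1)[OF D.finite D.bij_\<phi> _ d(1)])
    then have "d \<in> out_arcs G v" using d(2) by simp
    moreover obtain t where "t \<in> T" "orbit x t \<inter> orbit (x \<circ> z) t = {t}"
      using T type unfolding platonic_def by blast
    ultimately show False
      using exceptional_vertex_and_face(2)[OF odd _ d(1)] by blast
  qed
qed

end

theorem theorem1p2:
  fixes G :: "('v, 'd) pre_digraph"
    and arev rot :: "'d \<Rightarrow> 'd"
    and k l n :: nat
  assumes "plane_graph G arev rot"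
    and "k \<ge> 2" and "l \<ge> 2"
    and "n = card (map_edges G arev)"
  shows
    "\<not> uniform_of_type 1 k l G arev rot
   \<and> (\<forall>f g u v.
        uniform_of_type 2 k l G arev rot
        \<and> f \<in> exceptional_faces l G arev rot \<and> g \<in> exceptional_faces l G arev rot \<and> f \<noteq> g
        \<and> face_degree f = u \<and> face_degree g = v
        \<longrightarrow> gcd u l = gcd v l
          \<and> (\<forall>t. t = gcd u l \<and> t = gcd v l
               \<longrightarrow> of_nat n / platonic_edges k l * (of_nat l / of_nat t) \<in> \<int>)
          \<and> (k \<noteq> 2 \<longrightarrow> \<not> faces_adjacent G arev f g))
   \<and> (\<forall>x f.
        uniform_of_type 2 k l G arev rot
        \<and> x \<in> exceptional_vertices k G \<and> f \<in> exceptional_faces l G arev rot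
        \<longrightarrow> (k = 3 \<and> l = 3)
          \<and> even n
          \<and> \<not> incident G x f)"
proof -
  interpret plane_graph G arev rot by (rule assms(1))
  show ?thesis
  proof (intro conjI allI impI; (elim conjE)?)
    show "\<not> uniform_of_type 1 k l G arev rot" by (rule no_1_uniform[OF assms(2,3)])
  next
    fix f g u v
    assume "uniform_of_type 2 k l G arev rot" "f \<in> exceptional_faces l G arev rot"
      "g \<in> exceptional_faces l G arev rot" "f \<noteq> g" "face_degree f = u" "face_degree g = v"
    note uniform = two_uniform_faces[OF assms(2,3) this(1-4)]
      and degrees = \<open>face_degree f = u\<close> \<open>face_degree g = v\<close>
    show "gcd u l = gcd v l" using uniform(1) degrees by (simp add: face_degree_def)
    show "of_nat n / platonic_edges k l * (of_nat l / of_nat t) \<in> \<int>" if "t = gcd u l" for t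
      using uniform(2) degrees that by (simp add: face_degree_def assms(4))
    show "\<not> faces_adjacent G arev f g" if "k \<noteq> 2" using uniform(3) that by blast
  next
    fix x f
    assume "uniform_of_type 2 k l G arev rot" "x \<in> exceptional_vertices k G"
      "f \<in> exceptional_faces l G arev rot"
    note uniform = two_uniform_vertex_and_face[OF assms(2,3) this]
    show "k = 3" "l = 3" using uniform(1) by auto
    show "even n" using uniform(2) by (simp add: assms(4))
    show "\<not> incident G x f" by (rule uniform(3))
  qed
qed

end
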